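(* Let $L\ge M\ge 0$ be integers with $L\ge 1$, let $\mathbb T=\mathbb T_{L,M}$ be the $L\times M$ tube, and let $\mathcal F_{\mathbb T}(f)$ be the free energy of polygons in $\mathbb T$ subject to a force $f$. Then in the limit $f\to\infty$ the free energy is asymptotic to $f/2$, that is, $$\lim_{f\to\infty}\left(\mathcal F_{\mathbb T}(f)-\frac f2\right)=0.$$
   Context: The tube is $\mathbb T=\mathbb T_{L,M}=\{(x,y,z)\in\mathbb Z^3: x\ge 0,\ 0\le y\le L,\ 0\le z\le M\}$, with edges joining vertices at unit distance. A self-avoiding polygon is a finite subgraph of the cubic lattice $\mathbb Z^3$ that is a simple closed curve (a connected subgraph with every vertex of degree 2; unrooted and unoriented); its length is its number of edges. $\mathcal P_{\mathbb T}$ is the set of self-avoiding polygons in $\mathbb T$ which occupy at least one vertex in the plane $x=0$ (polygons differing by a translation in the $y$ or $z$ directions are counted as distinct). The span $s(\pi)$ of $\pi\in\mathcal P_{\mathbb T}$ is the maximal $x$-coordinate of its vertices. Let $p_{\mathbb T,n}(s)$ be the number of polygons in $\mathcal P_{\mathbb T}$ with $n$ edges and span $s$, and $$Z_{\mathbb T,n}(f)=\sum_s p_{\mathbb T,n}(s)e^{fs}.$$ The free energy is $\mathcal F_{\mathbb T}(f)=\lim_{n\to\infty}\frac1n\log Z_{\mathbb T,n}(f)$, where $n$ runs through even values only; this limit is known to exist for all real $f$. *)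

theory Defs
  imports Complex_Main
begin

type_synonym vertex = "int \<times> int \<times> int"

fun unit_dist :: "vertex \<Rightarrow> vertex \<Rightarrow> bool" where
  "unit_dist (x, y, z) (x', y', z') \<longleftrightarrow> (x - x')\<^sup>2 + (y - y')\<^sup>2 + (z - z')\<^sup>2 = 1"

definition lattice_edges :: "vertex set set" where
  "lattice_edges = {{u, v} | u v. unit_dist u v}"

text \<open>A subgraph without isolated vertices is determined by its edge set \<open>E\<close>, its vertex set
  being \<open>\<Union>E\<close>. Since every vertex of a polygon has degree 2, a polygon is represented by its edge
  set, which makes it unrooted and unoriented.\<close>

definition connected_edges :: "vertex set set \<Rightarrow> bool" where
  "connected_edges E \<longleftrightarrow> (\<forall>u \<in> \<Union>E. \<forall>v \<in> \<Union>E. (u, v) \<in> {(a, b). {a, b} \<in> E}\<^sup>*)"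

definition is_polygon :: "vertex set set \<Rightarrow> bool" where
  "is_polygon E \<longleftrightarrow> finite E \<and> E \<noteq> {} \<and> E \<subseteq> lattice_edges \<and> connected_edges E \<and>
     (\<forall>v \<in> \<Union>E. card {e \<in> E. v \<in> e} = 2)"

definition tube :: "nat \<Rightarrow> nat \<Rightarrow> vertex set" where
  "tube L M = {(x, y, z). 0 \<le> x \<and> 0 \<le> y \<and> y \<le> int L \<and> 0 \<le> z \<and> z \<le> int M}"

definition tube_polygons :: "nat \<Rightarrow> nat \<Rightarrow> vertex set set set" where
  "tube_polygons L M = {E. is_polygon E \<and> \<Union>E \<subseteq> tube L M \<and> (\<exists>v \<in> \<Union>E. fst v = 0)}"

definition polygon_span :: "vertex set set \<Rightarrow> int" where
  "polygon_span E = Max (fst ` \<Union>E)"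

definition num_polygons :: "nat \<Rightarrow> nat \<Rightarrow> nat \<Rightarrow> nat \<Rightarrow> nat" where
  "num_polygons L M n s = card {E \<in> tube_polygons L M. card E = n \<and> polygon_span E = int s}"

text \<open>Only finitely many terms of the series are nonzero, since the span is less than \<open>n\<close>.\<close>

definition partition_function :: "nat \<Rightarrow> nat \<Rightarrow> nat \<Rightarrow> real \<Rightarrow> real" where
  "partition_function L M n f = (\<Sum>s. real (num_polygons L M n s) * exp (f * real s))"

text \<open>The length runs through the even numbers \<open>n = 2 * k\<close>.\<close>

definition free_energy :: "nat \<Rightarrow> nat \<Rightarrow> real \<Rightarrow> real" where
  "free_energy L M f = lim (\<lambda>k. ln (partition_function L M (2 * k) f) / real (2 * k))"

end

theory Submission
  imports Defs "HOL-Library.FuncSet"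
begin

text \<open>A polygon of length \<open>n\<close> and span \<open>s\<close> has at least two edges between any two consecutive planes
  \<open>x = i\<close>, \<open>x = i + 1\<close> with \<open>0 \<le> i < s\<close>, so its excess \<open>n - 2 s\<close> is at least the number of planes
  containing an edge. The passage through a plane without edges is forced. Hence the polygons weighted by
  \<open>exp (- f / 2)\<close> per unit of excess have total weight of order \<open>(1 + C exp (- f / 2)) ^ (n / 2)\<close>, which
  bounds the free energy by \<open>f / 2 + ln (1 + C exp (- f / 2)) / 2\<close>. The straight \<open>1 \<times> s\<close> rectangle
  gives the lower bound \<open>f / 2\<close>.

  Since \<open>lim\<close> is only meaningful for convergent sequences, the limit has to be shown to exist for large
  \<open>f\<close>. Polygons whose two end planes contain a fixed corner edge can be concatenated without
  loss, so their partition function is supermultiplicative; every polygon is turned into such a one by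
  rerouting an edge in each of its end planes at bounded cost, and can be recovered from the result.\<close>

section \<open>Splicing polygons\<close>

text \<open>Each plane gets one symbol, and the number \<open>C\<close> of nontrivial symbols
  depends only on \<open>L\<close> and \<open>M\<close>; there are at most \<open>n / 2 + 1\<close>
  planes because the span is at most \<open>n / 2\<close>. The base \<open>exp (- f / 2)\<close>
  comes from writing \<open>exp (f * s)\<close> for length \<open>2 * k\<close> as
  \<open>exp (f * k)\<close> times the power \<open>2 * k - 2 * s\<close> of it.

  The obstacle to convergence is that the extreme edges of two polygons need not face each other, so
  arbitrary polygons cannot be joined end to end. A rerouting that aligns them must stay inside the
  tube, even if \<open>M = 0\<close> leaves a single row, must avoid occupied vertices and must be
  reversible. It therefore uses only fresh planes beyond the polygon, and its depth and cost depend
  only on the extreme edge. The pair of chosen end edges is then all that has to be remembered,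
  which costs a factor independent of the length and disappears from the limit.\<close>

abbreviation adj :: "vertex set set \<Rightarrow> (vertex \<times> vertex) set" where
  "adj E \<equiv> {(a, b). {a, b} \<in> E}"

lemma adj_rtrancl_sym: "(a, b) \<in> (adj E)\<^sup>* \<Longrightarrow> (b, a) \<in> (adj E)\<^sup>*"
proof -
  have "sym (adj E)" by (auto simp: sym_def insert_commute)
  then show "(a, b) \<in> (adj E)\<^sup>* \<Longrightarrow> (b, a) \<in> (adj E)\<^sup>*"
    by (meson sym_rtrancl symD)
qed

lemma adj_rtrancl_mono: "E \<subseteq> F \<Longrightarrow> (a, b) \<in> (adj E)\<^sup>* \<Longrightarrow> (a, b) \<in> (adj F)\<^sup>*"
  by (rule subsetD[OF rtrancl_mono]) auto

lemma unit_dist_sym: "unit_dist u v \<longleftrightarrow> unit_dist v u"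
  by (cases u; cases v) (simp add: power2_commute)

lemma unit_dist_irrefl: "\<not> unit_dist u u"
  by (cases u) simp

lemma lattice_edge_iff: "{u, v} \<in> lattice_edges \<longleftrightarrow> unit_dist u v"
  unfolding lattice_edges_def mem_Collect_eq doubleton_eq_iff using unit_dist_sym by blast

lemma lattice_edgeE:
  assumes "e \<in> lattice_edges"
  obtains u v where "e = {u, v}" "unit_dist u v" "u \<noteq> v"
  using assms unit_dist_irrefl unfolding lattice_edges_def by blast

lemma unit_dist_cases:
  assumes "unit_dist u v"
  shows "(fst u = fst v \<and> snd u \<noteq> snd v) \<or> (snd u = snd v \<and> (fst v = fst u + 1 \<or> fst u = fst v + 1))"
proof -
  obtain x y z where u: "u = (x, y, z)" by (cases u)
  obtain x' y' z' where v: "v = (x', y', z')" by (cases v)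
  have eq: "(x - x')\<^sup>2 + (y - y')\<^sup>2 + (z - z')\<^sup>2 = 1" using assms u v by simp
  show ?thesis
  proof (cases "x = x'")
    case True
    then show ?thesis using eq u v by auto
  next
    case False
    then have "(x - x')\<^sup>2 \<ge> 1" by (simp add: int_one_le_iff_zero_less)
    then have "(x - x')\<^sup>2 = 1 \<and> (y - y')\<^sup>2 = 0 \<and> (z - z')\<^sup>2 = 0"
      using eq zero_le_power2[of "y - y'"] zero_le_power2[of "z - z'"] by linarith
    then show ?thesis using u v by (auto simp: power2_eq_1_iff)
  qed
qed

text \<open>Double counting of incidences. The parity arguments below take \<open>C\<close> to be a
  component or a half-space: edges with both or neither endpoint in \<open>C\<close> contribute
  evenly.\<close>

lemma handshake:
  fixes E :: "'a set set"
  assumes "finite E" "finite C" "\<And>v. v \<in> C \<Longrightarrow> card {e \<in> E. v \<in> e} = 2"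
  shows "(\<Sum>e\<in>E. card (e \<inter> C)) = 2 * card C"
proof -
  have "(\<Sum>e\<in>E. card {v \<in> C. v \<in> e}) = 2 * card C"
    using assms by (intro sum_multicount) auto
  moreover have "{v \<in> C. v \<in> e} = e \<inter> C" for e by auto
  ultimately show ?thesis by simp
qed

lemma polygon_edgeE:
  assumes "is_polygon E" "e \<in> E"
  obtains u v where "e = {u, v}" "unit_dist u v" "u \<noteq> v"
  using assms lattice_edgeE unfolding is_polygon_def by (metis subsetD)

lemma polygon_finite: "is_polygon E \<Longrightarrow> finite E"
  by (simp add: is_polygon_def)

lemma polygon_finite_vertices: "is_polygon E \<Longrightarrow> finite (\<Union>E)"
  by (metis finite.emptyI finite_Union finite_insert polygon_edgeE polygon_finite)

lemma polygon_degree: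
  assumes "is_polygon E" "v \<in> \<Union>E"
  shows "card {e \<in> E. v \<in> e} = 2"
proof -
  have "\<forall>v \<in> \<Union>E. card {e \<in> E. v \<in> e} = 2" using assms(1) unfolding is_polygon_def by (elim conjE)
  then show ?thesis using assms(2) by (rule bspec)
qed

text \<open>A graph with all degrees 2 has no bridge. If \<open>v\<close> were unreachable from
  \<open>u\<close>, every other edge would meet the component \<open>C\<close> of \<open>u\<close>
  in 0 or 2 vertices and \<open>{u, v}\<close> would meet it in one, so the incidence sum would be
  odd, yet it equals \<open>2 * card C\<close>.\<close>

lemma polygon_remove_edge_connected:
  assumes P: "is_polygon E" and uv: "{u, v} \<in> E"
  shows "(u, v) \<in> (adj (E - {{u, v}}))\<^sup>*"
proof (rule ccontr)
  let ?F = "E - {{u, v}}"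
  assume nv: "(u, v) \<notin> (adj ?F)\<^sup>*"
  define C where "C = {w \<in> \<Union>E. (u, w) \<in> (adj ?F)\<^sup>*}"
  have fin: "finite E" "finite C"
    using polygon_finite[OF P] finite_subset[OF _ polygon_finite_vertices[OF P], of C]
    by (auto simp: C_def)
  have "(\<Sum>e\<in>E. card (e \<inter> C)) = 2 * card C"
    by (rule handshake) (use fin polygon_degree[OF P] in \<open>auto simp: C_def\<close>)
  moreover have "{u, v} \<inter> C = {u}"
    using uv nv by (auto simp: C_def)
  then have "(\<Sum>e\<in>E. card (e \<inter> C)) = 1 + (\<Sum>e\<in>?F. card (e \<inter> C))"
    using sum.remove[OF fin(1) uv, of "\<lambda>e. card (e \<inter> C)"] by simp
  moreover have "even (\<Sum>e\<in>?F. card (e \<inter> C))"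
  proof (rule dvd_sum)
    fix e assume e: "e \<in> ?F"
    then obtain a b where ab: "e = {a, b}" "a \<noteq> b" using polygon_edgeE[OF P] by (metis Diff_iff)
    have adj: "(a, b) \<in> adj ?F" "(b, a) \<in> adj ?F" using e ab by (auto simp: insert_commute)
    have "(u, a) \<in> (adj ?F)\<^sup>* \<longleftrightarrow> (u, b) \<in> (adj ?F)\<^sup>*"
      using rtrancl_into_rtrancl[OF _ adj(1)] rtrancl_into_rtrancl[OF _ adj(2)] by metis
    moreover have "a \<in> \<Union>E" "b \<in> \<Union>E" using e ab by auto
    ultimately have "a \<in> C \<longleftrightarrow> b \<in> C" unfolding C_def mem_Collect_eq by metis
    then have "e \<inter> C = e \<or> e \<inter> C = {}" using ab by auto
    then show "even (card (e \<inter> C))" using ab by auto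
  qed
  ultimately show False by presburger
qed

text \<open>A simple path described by degrees, so that degrees can be added up when arcs are
  joined. Reachability is asked from \<open>a\<close> only, since \<open>adj\<close> is
  symmetric.\<close>

definition is_arc :: "vertex set set \<Rightarrow> vertex \<Rightarrow> vertex \<Rightarrow> bool" where
  "is_arc F a b \<longleftrightarrow> finite F \<and> F \<subseteq> lattice_edges \<and> a \<noteq> b \<and> a \<in> \<Union>F \<and> b \<in> \<Union>F \<and>
     (\<forall>w \<in> \<Union>F. (a, w) \<in> (adj F)\<^sup>*) \<and>
     (\<forall>w \<in> \<Union>F. card {e \<in> F. w \<in> e} = (if w = a \<or> w = b then 1 else 2))"

lemma is_arc_degree:
  assumes "is_arc F a b" "w \<in> \<Union>F"
  shows "card {e \<in> F. w \<in> e} = (if w = a \<or> w = b then 1 else 2)"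
proof -
  have "\<forall>w \<in> \<Union>F. card {e \<in> F. w \<in> e} = (if w = a \<or> w = b then 1 else 2)"
    using assms(1) unfolding is_arc_def by (elim conjE)
  then show ?thesis using assms(2) by (rule bspec)
qed

lemma is_arc_single:
  assumes "unit_dist a b"
  shows "is_arc {{a, b}} a b"
proof -
  have "a \<noteq> b" using assms unit_dist_irrefl by metis
  moreover have "(a, b) \<in> adj {{a, b}}" by simp
  then have "(a, w) \<in> (adj {{a, b}})\<^sup>*" if "w \<in> {a, b}" for w
    using that by (metis insertE r_into_rtrancl rtrancl.rtrancl_refl singletonD)
  moreover have "{e \<in> {{a, b}}. w \<in> e} = {{a, b}}" if "w \<in> {a, b}" for w
    using that by blast
  then have "card {e \<in> {{a, b}}. w \<in> e} = 1" if "w \<in> {a, b}" for w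
    using that by simp
  ultimately show ?thesis
    unfolding is_arc_def using assms by (simp add: lattice_edge_iff)
qed

lemma Union_polygon_remove_edge:
  assumes "is_polygon E"
  shows "\<Union>(E - {e}) = \<Union>E"
proof
  show "\<Union>E \<subseteq> \<Union>(E - {e})"
  proof
    fix v assume v: "v \<in> \<Union>E"
    have "\<not> {e \<in> E. v \<in> e} \<subseteq> {e}"
      using polygon_degree[OF assms v] card_mono[of "{e}" "{e \<in> E. v \<in> e}"] by auto
    then show "v \<in> \<Union>(E - {e})" by blast
  qed
qed auto

text \<open>Every passage of a walk through \<open>{u, v}\<close> is replaced by the detour that
  exists because the edge is not a bridge.\<close>

lemma is_arc_polygon_remove_edge:
  assumes P: "is_polygon E" and uv: "{u, v} \<in> E"
  shows "is_arc (E - {{u, v}}) u v"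
proof -
  let ?F = "E - {{u, v}}"
  have ne: "u \<noteq> v" using polygon_edgeE[OF P uv] by (metis doubleton_eq_iff)
  have "adj E \<subseteq> (adj ?F)\<^sup>*"
  proof
    fix x assume "x \<in> adj E"
    then obtain a b where x: "x = (a, b)" "{a, b} \<in> E" by auto
    show "x \<in> (adj ?F)\<^sup>*"
    proof (cases "{a, b} = {u, v}")
      case True
      then have "x = (u, v) \<or> x = (v, u)" using x by (simp add: doubleton_eq_iff)
      then show ?thesis
        using polygon_remove_edge_connected[OF P uv] adj_rtrancl_sym by metis
    next
      case False
      then have "x \<in> adj ?F" using x by simp
      then show ?thesis by (rule r_into_rtrancl)
    qed
  qed
  then have "(adj E)\<^sup>* \<subseteq> (adj ?F)\<^sup>*" by (rule rtrancl_subset_rtrancl)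
  moreover have "\<forall>w \<in> \<Union>E. (u, w) \<in> (adj E)\<^sup>*"
    using P uv unfolding is_polygon_def connected_edges_def by blast
  ultimately have conn: "(u, w) \<in> (adj ?F)\<^sup>*" if "w \<in> \<Union>E" for w using that by blast
  have deg: "card {e \<in> ?F. w \<in> e} = (if w = u \<or> w = v then 1 else 2)" if w: "w \<in> \<Union>E" for w
  proof (cases "w = u \<or> w = v")
    case True
    then have "{e \<in> ?F. w \<in> e} = {e \<in> E. w \<in> e} - {{u, v}}" by auto
    then show ?thesis using True uv polygon_degree[OF P w] polygon_finite[OF P] by (simp add: card_Diff_singleton)
  next
    case False
    then have "{e \<in> ?F. w \<in> e} = {e \<in> E. w \<in> e}" by auto
    then show ?thesis using False polygon_degree[OF P w] by simp
  qed
  have "finite ?F" "?F \<subseteq> lattice_edges" using P by (auto simp: is_polygon_def)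
  moreover have "u \<in> \<Union>E" "v \<in> \<Union>E" using uv by blast+
  ultimately show ?thesis
    unfolding is_arc_def Union_polygon_remove_edge[OF P]
    using ne by (intro conjI ballI conn deg)
qed

text \<open>\<open>E\<close> is opened at one edge and closed again through the arc
  \<open>F\<close>: each of the four endpoints has degree 1 in its own arc and gains one connecting
  edge. A single edge as \<open>F\<close> gives an outward push, a polygon less an edge gives
  concatenation.\<close>

lemma splice:
  assumes P: "is_polygon E" and uv: "{u, v} \<in> E" and A: "is_arc F u' v'"
    and disj: "\<Union>F \<inter> \<Union>E = {}" and uu': "unit_dist u u'" and vv': "unit_dist v v'"
  defines "G \<equiv> E - {{u, v}} \<union> F \<union> {{u, u'}, {v, v'}}"
  shows "is_polygon G" and "card G = card E + card F + 1" and "\<Union>G = \<Union>E \<union> \<Union>F"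
proof -
  let ?D = "E - {{u, v}}"
  have D: "is_arc ?D u v" by (rule is_arc_polygon_remove_edge[OF P uv])
  have UD: "\<Union>?D = \<Union>E" by (rule Union_polygon_remove_edge[OF P])
  have u: "u \<in> \<Union>E" "v \<in> \<Union>E" "u \<noteq> v" using uv D by (auto simp: is_arc_def)
  have u': "u' \<in> \<Union>F" "v' \<in> \<Union>F" "u' \<noteq> v'" using A by (auto simp: is_arc_def)
  have nin: "u \<notin> \<Union>F" "v \<notin> \<Union>F" "u' \<notin> \<Union>E" "v' \<notin> \<Union>E" using u u' disj by auto
  have fin: "finite ?D" "finite F" using D A by (auto simp: is_arc_def)
  show UG: "\<Union>G = \<Union>E \<union> \<Union>F" unfolding G_def using UD u u' by auto
  have d: "?D \<inter> F = {}"
  proof (rule ccontr)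
    assume "?D \<inter> F \<noteq> {}"
    then obtain e where e: "e \<in> E" "e \<in> F" by auto
    then obtain a b where "e = {a, b}" using polygon_edgeE[OF P] by metis
    then show False using e disj by blast
  qed
  have nin2: "{u, u'} \<notin> ?D \<union> F" "{v, v'} \<notin> ?D \<union> F" "{u, u'} \<noteq> {v, v'}"
    using nin u u' by (auto simp: doubleton_eq_iff)
  have "card G = card (?D \<union> F) + 2"
    unfolding G_def using fin nin2 by simp
  also have "card (?D \<union> F) = card ?D + card F" using fin d by (rule card_Un_disjoint)
  also have "card ?D = card E - 1" using uv polygon_finite[OF P] by simp
  finally show "card G = card E + card F + 1"
    using uv polygon_finite[OF P] by (cases "card E") auto
  have conn: "(u, w) \<in> (adj G)\<^sup>*" if "w \<in> \<Union>G" for w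
  proof (cases "w \<in> \<Union>E")
    case True
    then have "(u, w) \<in> (adj ?D)\<^sup>*" using D UD by (auto simp: is_arc_def)
    then show ?thesis by (rule adj_rtrancl_mono[rotated]) (auto simp: G_def)
  next
    case False
    then have "(u', w) \<in> (adj F)\<^sup>*" using that UG A by (auto simp: is_arc_def)
    then have "(u', w) \<in> (adj G)\<^sup>*" by (rule adj_rtrancl_mono[rotated]) (auto simp: G_def)
    moreover have "(u, u') \<in> adj G" by (auto simp: G_def)
    ultimately show ?thesis by (rule converse_rtrancl_into_rtrancl[rotated])
  qed
  have deg: "card {e \<in> G. w \<in> e} = 2" if "w \<in> \<Union>G" for w
  proof -
    define S where "S = {e \<in> {{u, u'}, {v, v'}}. w \<in> e}"
    have filter_Un: "{e \<in> A \<union> B. w \<in> e} = {e \<in> A. w \<in> e} \<union> {e \<in> B. w \<in> e}"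
      for A B :: "vertex set set" by blast
    have S_sub: "S \<subseteq> {{u, u'}, {v, v'}}" unfolding S_def by blast
    have "finite S" using finite_subset[OF S_sub] by simp
    moreover have "({e \<in> ?D. w \<in> e} \<union> {e \<in> F. w \<in> e}) \<inter> S = {}"
      using S_sub nin2 by blast
    ultimately have "card {e \<in> G. w \<in> e} = card ({e \<in> ?D. w \<in> e} \<union> {e \<in> F. w \<in> e}) + card S"
      unfolding G_def filter_Un S_def[symmetric] using fin by (intro card_Un_disjoint) simp_all
    also have "card ({e \<in> ?D. w \<in> e} \<union> {e \<in> F. w \<in> e}) = card {e \<in> ?D. w \<in> e} + card {e \<in> F. w \<in> e}"
      using fin d by (intro card_Un_disjoint) (simp_all, blast)
    finally have G: "card {e \<in> G. w \<in> e} = card {e \<in> ?D. w \<in> e} + card {e \<in> F. w \<in> e} + card S" .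
    \<comment> \<open>No vertex lies on both connecting edges, so \<open>S\<close> supplies exactly
      the degree that is missing at the four endpoints.\<close>
    have S0: "S = (if w = u \<or> w = u' then {{u, u'}} else if w = v \<or> w = v' then {{v, v'}} else {})"
    proof -
      have "\<not> ((w = u \<or> w = u') \<and> (w = v \<or> w = v'))" using u u' nin by metis
      then show ?thesis unfolding S_def by (simp add: Collect_disj_eq Collect_conv_if conj_disj_distribR)
    qed
    have D0: "card {e \<in> ?D. w \<in> e} = (if w = u \<or> w = v then 1 else 2)" if "w \<in> \<Union>E"
      using is_arc_degree[OF D] that UD by simp
    have F0: "card {e \<in> F. w \<in> e} = (if w = u' \<or> w = v' then 1 else 2)" if "w \<in> \<Union>F"
      using is_arc_degree[OF A that] .
    consider "w \<in> \<Union>E" "w \<notin> \<Union>F" | "w \<notin> \<Union>E" "w \<in> \<Union>F"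
      using \<open>w \<in> \<Union>G\<close> disj unfolding UG by (meson UnE disjoint_iff)
    then show ?thesis
    proof cases
      case 1
      have "{e \<in> F. w \<in> e} = {}" using 1(2) by blast
      then have z: "card {e \<in> F. w \<in> e} = 0" by (simp only: card.empty)
      moreover have "w \<noteq> u'" "w \<noteq> v'" using 1 nin by metis+
      ultimately show ?thesis unfolding G z D0[OF 1(1)] S0 by simp
    next
      case 2
      have "{e \<in> ?D. w \<in> e} = {}" using 2(1) by blast
      then have z: "card {e \<in> ?D. w \<in> e} = 0" by (simp only: card.empty)
      moreover have "w \<noteq> u" "w \<noteq> v" using 2 nin by metis+
      ultimately show ?thesis unfolding G z F0[OF 2(2)] S0 by simp
    qed
  qed
  show "is_polygon G"
    unfolding is_polygon_def connected_edges_def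
  proof (intro conjI ballI)
    show "finite G" "G \<noteq> {}" using fin by (auto simp: G_def)
    show "G \<subseteq> lattice_edges"
    proof -
      have "?D \<subseteq> lattice_edges" "F \<subseteq> lattice_edges"
        using D A unfolding is_arc_def by blast+
      then show ?thesis using uu' vv' unfolding G_def by (simp add: lattice_edge_iff)
    qed
    show "(a, b) \<in> (adj G)\<^sup>*" if "a \<in> \<Union>G" "b \<in> \<Union>G" for a b
      by (rule rtrancl_trans[OF adj_rtrancl_sym[OF conn[OF that(1)]] conn[OF that(2)]])
  qed (rule deg)
qed

section \<open>Rerouting an edge of an end plane\<close>

lemma unit_dist_plane: "unit_dist (x, p) (x, q) \<longleftrightarrow> unit_dist (0, p) (0, q)"
  by (cases p; cases q) simp

lemma unit_dist_axis: "unit_dist (x, p) (x', p) \<longleftrightarrow> \<bar>x - x'\<bar> = 1"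
  by (cases p) (simp add: power2_eq_1_iff, arith)

section \<open>Transport along symmetries of the lattice\<close>

definition lattice_embedding :: "(vertex \<Rightarrow> vertex) \<Rightarrow> bool" where
  "lattice_embedding \<phi> \<longleftrightarrow> inj \<phi> \<and> (\<forall>u v. unit_dist (\<phi> u) (\<phi> v) \<longleftrightarrow> unit_dist u v)"

lemma Union_image_image: "\<Union>((`) \<phi> ` E) = \<phi> ` \<Union>E"
  by blast

lemma inj_image: "inj \<phi> \<Longrightarrow> inj ((`) \<phi>)"
  by (simp add: inj_def inj_image_eq_iff)

lemma card_image_image: "inj \<phi> \<Longrightarrow> card ((`) \<phi> ` E) = card E"
  by (meson card_image inj_image inj_on_subset subset_UNIV)

lemma polygon_image:
  assumes \<phi>: "lattice_embedding \<phi>" and P: "is_polygon E"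
  shows "is_polygon ((`) \<phi> ` E)"
proof -
  let ?F = "(`) \<phi> ` E"
  have inj: "inj \<phi>" and ud: "unit_dist (\<phi> u) (\<phi> v) \<longleftrightarrow> unit_dist u v" for u v
    using \<phi> unfolding lattice_embedding_def by blast+
  have conn: "(\<phi> a, \<phi> b) \<in> (adj ?F)\<^sup>*" if "(a, b) \<in> (adj E)\<^sup>*" for a b
    using that
  proof induction
    case (step b c)
    have "(\<phi> b, \<phi> c) \<in> adj ?F"
      using step(2) imageI[of "{b, c}" E "(`) \<phi>"] by simp
    with step(3) show ?case by (rule rtrancl_into_rtrancl)
  qed simp
  have deg: "card {e \<in> ?F. \<phi> v \<in> e} = 2" if "v \<in> \<Union>E" for v
  proof -
    have "{e \<in> ?F. \<phi> v \<in> e} = (`) \<phi> ` {e \<in> E. v \<in> e}"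
      using inj_image_mem_iff[OF inj] by blast
    then show ?thesis using card_image_image[OF inj] polygon_degree[OF P that] by metis
  qed
  have lat: "?F \<subseteq> lattice_edges"
  proof
    fix f assume "f \<in> ?F"
    then obtain e where e: "e \<in> E" "f = \<phi> ` e" by blast
    obtain u v where "e = {u, v}" "unit_dist u v" by (rule polygon_edgeE[OF P e(1)])
    then show "f \<in> lattice_edges" using e ud by (simp add: lattice_edge_iff)
  qed
  have E: "finite E" "E \<noteq> {}" "connected_edges E" using P by (simp_all add: is_polygon_def)
  show ?thesis
    unfolding is_polygon_def connected_edges_def Union_image_image
  proof (intro conjI ballI)
    fix u v assume "u \<in> \<phi> ` \<Union>E" "v \<in> \<phi> ` \<Union>E"
    then obtain a b where "u = \<phi> a" "v = \<phi> b" "a \<in> \<Union>E" "b \<in> \<Union>E" by (elim imageE)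
    then show "(u, v) \<in> (adj ?F)\<^sup>*"
      using E(3) conn unfolding connected_edges_def by metis
  next
    fix v assume "v \<in> \<phi> ` \<Union>E"
    then obtain a where "v = \<phi> a" "a \<in> \<Union>E" by (elim imageE)
    then show "card {e \<in> ?F. v \<in> e} = 2" by (simp only: deg)
  qed (use E lat in simp_all)
qed

definition shift :: "int \<Rightarrow> vertex \<Rightarrow> vertex" where
  "shift a v = (fst v + a, snd v)"

definition reflect :: "vertex \<Rightarrow> vertex" where
  "reflect v = (- fst v, snd v)"

lemma fst_shift [simp]: "fst (shift a v) = fst v + a"
  and snd_shift [simp]: "snd (shift a v) = snd v"
  and shift_Pair [simp]: "shift a (x, p) = (x + a, p)"
  and shift_shift [simp]: "shift a (shift b v) = shift (a + b) v"
  and shift_0 [simp]: "shift 0 v = v"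
  by (simp_all add: shift_def)

lemma fst_reflect [simp]: "fst (reflect v) = - fst v"
  and snd_reflect [simp]: "snd (reflect v) = snd v"
  and reflect_Pair [simp]: "reflect (x, p) = (- x, p)"
  and reflect_reflect [simp]: "reflect (reflect v) = v"
  by (simp_all add: reflect_def)

lemma lattice_embedding_shift: "lattice_embedding (shift a)"
  unfolding lattice_embedding_def
proof (intro conjI allI)
  show "inj (shift a)" by (auto simp: inj_def shift_def prod_eq_iff)
  show "unit_dist (shift a u) (shift a v) = unit_dist u v" for u v
    by (cases u; cases v) simp
qed

lemma lattice_embedding_reflect: "lattice_embedding reflect"
  unfolding lattice_embedding_def
proof (intro conjI allI)
  show "inj reflect" by (auto simp: inj_def reflect_def prod_eq_iff)
  show "unit_dist (reflect u) (reflect v) = unit_dist u v" for u v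
    by (cases u; cases v) (simp add: power2_commute)
qed

lemma inj_shift: "inj (shift a)" and inj_reflect: "inj reflect"
  using lattice_embedding_shift lattice_embedding_reflect by (simp_all add: lattice_embedding_def)

lemma shift_image_shift_image: "(`) (shift a) ` (`) (shift b) ` E = (`) (shift (a + b)) ` E"
  by (simp add: image_image)

lemma shift_image_0: "(`) (shift 0) ` E = E"
proof -
  have "shift 0 = id" by (rule ext) simp
  then show ?thesis by simp
qed

lemma reflect_image_reflect_image: "(`) reflect ` (`) reflect ` E = E"
  by (simp add: image_image)

text \<open>\<open>Q\<close> arises from \<open>E\<close> by rerouting the edge \<open>e\<close> outside the region \<open>H\<close>, so that \<open>E\<close> can be
  recovered from \<open>Q\<close>, \<open>H\<close> and \<open>e\<close>.\<close>

definition extends :: "vertex set \<Rightarrow> vertex set \<Rightarrow> vertex set set \<Rightarrow> vertex set set \<Rightarrow> bool" where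
  "extends H e E Q \<longleftrightarrow> is_polygon Q \<and> \<Union>E \<subseteq> \<Union>Q \<and> \<Union>Q \<inter> H \<subseteq> \<Union>E \<and> {f \<in> Q. f \<subseteq> H} = E - {e}"

lemma
  assumes "extends H e E Q"
  shows extends_polygon: "is_polygon Q" and extends_vertices: "\<Union>E \<subseteq> \<Union>Q"
    and extends_new_vertices: "\<Union>Q \<inter> H \<subseteq> \<Union>E" and extends_edges: "{f \<in> Q. f \<subseteq> H} = E - {e}"
  using assms unfolding extends_def by simp_all

text \<open>The second rerouting deletes and adds only edges that are not inside the smaller region
  \<open>H\<close>, so the trace of the first one on \<open>H\<close> survives.\<close>

lemma extends_trans:
  assumes "extends H e E Q" "extends H' e' Q R" "H \<subseteq> H'" "\<not> e' \<subseteq> H"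
  shows "extends H e E R"
proof -
  have "{f \<in> R. f \<subseteq> H} = {f \<in> {f \<in> R. f \<subseteq> H'}. f \<subseteq> H}" using assms(3) by blast
  also have "\<dots> = {f \<in> Q - {e'}. f \<subseteq> H}" using assms(2) by (simp add: extends_def)
  also have "\<dots> = {f \<in> Q. f \<subseteq> H}" using assms(4) by blast
  also have "\<dots> = E - {e}" using assms(1) by (simp add: extends_def)
  finally have "{f \<in> R. f \<subseteq> H} = E - {e}" .
  moreover have "\<Union>E \<subseteq> \<Union>R"
    using extends_vertices[OF assms(1)] extends_vertices[OF assms(2)] by (rule subset_trans)
  moreover have "\<Union>R \<inter> H \<subseteq> \<Union>R \<inter> H' \<inter> H" using assms(3) by blast
  then have "\<Union>R \<inter> H \<subseteq> \<Union>Q \<inter> H" using extends_new_vertices[OF assms(2)] by blast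
  then have "\<Union>R \<inter> H \<subseteq> \<Union>E" using extends_new_vertices[OF assms(1)] by (rule subset_trans)
  ultimately show ?thesis using extends_polygon[OF assms(2)] unfolding extends_def by simp
qed

lemma extends_image:
  assumes \<phi>: "lattice_embedding \<phi>" and ex: "extends H e E Q"
  shows "extends (\<phi> ` H) (\<phi> ` e) ((`) \<phi> ` E) ((`) \<phi> ` Q)"
proof -
  have inj: "inj \<phi>" using \<phi> by (simp add: lattice_embedding_def)
  note Q = extends_polygon[OF ex] extends_vertices[OF ex] extends_new_vertices[OF ex] extends_edges[OF ex]
  have "\<phi> ` \<Union>Q \<inter> \<phi> ` H = \<phi> ` (\<Union>Q \<inter> H)" using image_Int[OF inj] by metis
  then have "\<phi> ` \<Union>Q \<inter> \<phi> ` H \<subseteq> \<phi> ` \<Union>E" using image_mono[OF Q(3)] by metis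
  moreover have "{f \<in> (`) \<phi> ` Q. f \<subseteq> \<phi> ` H} = (`) \<phi> ` {f \<in> Q. f \<subseteq> H}"
    using inj_image_subset_iff[OF inj] by blast
  then have "{f \<in> (`) \<phi> ` Q. f \<subseteq> \<phi> ` H} = (`) \<phi> ` E - {\<phi> ` e}"
    using Q(4) image_set_diff[OF inj_image[OF inj], of E "{e}"] by simp
  ultimately show ?thesis
    unfolding extends_def Union_image_image
    using polygon_image[OF \<phi> Q(1)] image_mono[OF Q(2)] by simp
qed

text \<open>The elementary move: an edge is replaced by the other three sides of a unit square whose
  far side avoids \<open>H\<close>. The region is arbitrary because a sideways push needs more than
  a half-space.\<close>

lemma push:
  assumes P: "is_polygon E" and uv: "{u, v} \<in> E" and H: "\<Union>E \<subseteq> H" "u' \<notin> H" "v' \<notin> H"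
    and ud: "unit_dist u u'" "unit_dist v v'" "unit_dist u' v'"
  defines "Q \<equiv> E - {{u, v}} \<union> {{u', v'}} \<union> {{u, u'}, {v, v'}}"
  shows "extends H {u, v} E Q" and "card Q = card E + 2" and "\<Union>Q = \<Union>E \<union> {u', v'}"
proof -
  have disj: "\<Union>{{u', v'}} \<inter> \<Union>E = {}" using H by auto
  note s = splice[OF P uv is_arc_single[OF ud(3)] disj ud(1,2), folded Q_def]
  show "card Q = card E + 2" using s(2) by simp
  show U: "\<Union>Q = \<Union>E \<union> {u', v'}" using s(3) by simp
  have "f \<subseteq> H" if "f \<in> E" for f using that H(1) by (meson Union_upper order_trans)
  moreover have "\<not> {u', v'} \<subseteq> H" "\<not> {u, u'} \<subseteq> H" "\<not> {v, v'} \<subseteq> H" using H by simp_all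
  ultimately have edges: "{f \<in> Q. f \<subseteq> H} = E - {{u, v}}" unfolding Q_def by blast
  have new: "\<Union>Q \<inter> H \<subseteq> \<Union>E" unfolding U using H by simp
  have old: "\<Union>E \<subseteq> \<Union>Q" unfolding U by (rule Un_upper1)
  show "extends H {u, v} E Q" unfolding extends_def by (intro conjI s(1) old new edges)
qed

section \<open>Moving an extreme edge into the corner\<close>

definition grid :: "nat \<Rightarrow> nat \<Rightarrow> (int \<times> int) set" where
  "grid L M = {0..int L} \<times> {0..int M}"

text \<open>The bound on \<open>fst v\<close> together with the edge makes \<open>x\<close> the
  leftmost plane. Depth \<open>m\<close> and cost \<open>2 * j\<close> are fixed before
  \<open>E\<close>, so they are uniform over all polygons; an even cost keeps the length
  even.\<close>

definition left_reroute ::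
  "(int \<times> int) set \<Rightarrow> int \<times> int \<Rightarrow> int \<times> int \<Rightarrow> int \<times> int \<Rightarrow> int \<times> int \<Rightarrow> int \<Rightarrow> nat \<Rightarrow> bool" where
  "left_reroute G p q p' q' m j \<longleftrightarrow> (\<forall>x E. is_polygon E \<and> (\<forall>v\<in>\<Union>E. x \<le> fst v \<and> snd v \<in> G) \<and>
     {(x, p), (x, q)} \<in> E \<longrightarrow> (\<exists>Q. extends {v. x \<le> fst v} {(x, p), (x, q)} E Q \<and>
       (\<forall>v\<in>\<Union>Q. x - m \<le> fst v \<and> snd v \<in> G) \<and> {(x - m, p'), (x - m, q')} \<in> Q \<and>
       card Q = card E + 2 * j))"

definition right_reroute ::
  "(int \<times> int) set \<Rightarrow> int \<times> int \<Rightarrow> int \<times> int \<Rightarrow> int \<times> int \<Rightarrow> int \<times> int \<Rightarrow> int \<Rightarrow> nat \<Rightarrow> bool" where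
  "right_reroute G p q p' q' m j \<longleftrightarrow> (\<forall>x E. is_polygon E \<and> (\<forall>v\<in>\<Union>E. fst v \<le> x \<and> snd v \<in> G) \<and>
     {(x, p), (x, q)} \<in> E \<longrightarrow> (\<exists>Q. extends {v. fst v \<le> x} {(x, p), (x, q)} E Q \<and>
       (\<forall>v\<in>\<Union>Q. fst v \<le> x + m \<and> snd v \<in> G) \<and> {(x + m, p'), (x + m, q')} \<in> Q \<and>
       card Q = card E + 2 * j))"

lemma left_reroute_commute: "left_reroute G p q p' q' m j \<longleftrightarrow> left_reroute G q p p' q' m j"
  unfolding left_reroute_def by (simp only: insert_commute)

lemma left_rerouteE:
  assumes "left_reroute G p q p' q' m j" "is_polygon E" "\<forall>v\<in>\<Union>E. x \<le> fst v \<and> snd v \<in> G"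
    "{(x, p), (x, q)} \<in> E"
  obtains Q where "extends {v. x \<le> fst v} {(x, p), (x, q)} E Q"
    "\<forall>v\<in>\<Union>Q. x - m \<le> fst v \<and> snd v \<in> G" "{(x - m, p'), (x - m, q')} \<in> Q" "card Q = card E + 2 * j"
  using assms(1)[unfolded left_reroute_def, rule_format, OF conjI[OF assms(2) conjI[OF assms(3,4)]]]
  by (elim exE conjE) (rule that)

lemma right_rerouteE:
  assumes "right_reroute G p q p' q' m j" "is_polygon E" "\<forall>v\<in>\<Union>E. fst v \<le> x \<and> snd v \<in> G"
    "{(x, p), (x, q)} \<in> E"
  obtains Q where "extends {v. fst v \<le> x} {(x, p), (x, q)} E Q"
    "\<forall>v\<in>\<Union>Q. fst v \<le> x + m \<and> snd v \<in> G" "{(x + m, p'), (x + m, q')} \<in> Q" "card Q = card E + 2 * j"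
  using assms(1)[unfolded right_reroute_def, rule_format, OF conjI[OF assms(2) conjI[OF assms(3,4)]]]
  by (elim exE conjE) (rule that)

lemma left_reroute_trans:
  assumes 1: "left_reroute G p q p' q' m j" and 2: "left_reroute G p' q' p'' q'' m' j'" and m: "1 \<le> m"
  shows "left_reroute G p q p'' q'' (m + m') (j + j')"
  unfolding left_reroute_def
proof (intro allI impI, elim conjE)
  fix x E
  assume E: "is_polygon E" "\<forall>v\<in>\<Union>E. x \<le> fst v \<and> snd v \<in> G" "{(x, p), (x, q)} \<in> E"
  obtain Q where Q: "extends {v. x \<le> fst v} {(x, p), (x, q)} E Q"
    "\<forall>v\<in>\<Union>Q. x - m \<le> fst v \<and> snd v \<in> G" "{(x - m, p'), (x - m, q')} \<in> Q" "card Q = card E + 2 * j"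
    by (rule left_rerouteE[OF 1 E])
  obtain R where R: "extends {v. x - m \<le> fst v} {(x - m, p'), (x - m, q')} Q R"
    "\<forall>v\<in>\<Union>R. x - m - m' \<le> fst v \<and> snd v \<in> G" "{(x - m - m', p''), (x - m - m', q'')} \<in> R"
    "card R = card Q + 2 * j'"
    by (rule left_rerouteE[OF 2 extends_polygon[OF Q(1)] Q(2,3)])
  \<comment> \<open>\<open>1 \<le> m\<close> puts the intermediate edge outside the half-space, so
    deleting it leaves the trace on that half-space unchanged.\<close>
  have "extends {v. x \<le> fst v} {(x, p), (x, q)} E R"
    by (rule extends_trans[OF Q(1) R(1)]) (use m in auto)
  then show "\<exists>Q. extends {v. x \<le> fst v} {(x, p), (x, q)} E Q \<and>
       (\<forall>v\<in>\<Union>Q. x - (m + m') \<le> fst v \<and> snd v \<in> G) \<and> {(x - (m + m'), p''), (x - (m + m'), q'')} \<in> Q \<and>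
       card Q = card E + 2 * (j + j')"
    using R(2-4) Q(4) by (intro exI[of _ R]) (simp add: diff_diff_eq)
qed

text \<open>The last conclusion exposes a longitudinal edge, the one that a turn pushes
  sideways.\<close>

lemma push_left:
  assumes E: "is_polygon E" and V: "\<Union>E \<subseteq> {v. x \<le> fst v}" and e: "{(x, p), (x, q)} \<in> E"
  obtains Q where "extends {v. x \<le> fst v} {(x, p), (x, q)} E Q" "card Q = card E + 2"
    "\<Union>Q = \<Union>E \<union> {(x - 1, p), (x - 1, q)}" "{(x - 1, p), (x - 1, q)} \<in> Q" "{(x, p), (x - 1, p)} \<in> Q"
proof -
  let ?Q = "E - {{(x, p), (x, q)}} \<union> {{(x - 1, p), (x - 1, q)}} \<union> {{(x, p), (x - 1, p)}, {(x, q), (x - 1, q)}}"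
  have H: "(x - 1, p) \<notin> {v. x \<le> fst v}" "(x - 1, q) \<notin> {v. x \<le> fst v}" by auto
  have "unit_dist (x, p) (x, q)"
    using E e lattice_edge_iff unfolding is_polygon_def by (meson subsetD)
  then have ud: "unit_dist (x, p) (x - 1, p)" "unit_dist (x, q) (x - 1, q)" "unit_dist (x - 1, p) (x - 1, q)"
    using unit_dist_plane[of x p q] unit_dist_plane[of "x - 1" p q] by (simp_all add: unit_dist_axis)
  show ?thesis by (rule that[OF push[OF E e V H ud]]) blast+
qed

lemma left_reroute_straight: "left_reroute G p q p q 1 1"
  unfolding left_reroute_def
proof (intro allI impI, elim conjE)
  fix x E
  assume E: "is_polygon E" and V: "\<forall>v\<in>\<Union>E. x \<le> fst v \<and> snd v \<in> G" and e: "{(x, p), (x, q)} \<in> E"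
  have "\<Union>E \<subseteq> {v. x \<le> fst v}" using V by blast
  from push_left[OF E this e] obtain Q where
    Q: "extends {v. x \<le> fst v} {(x, p), (x, q)} E Q" "card Q = card E + 2"
      "\<Union>Q = \<Union>E \<union> {(x - 1, p), (x - 1, q)}" "{(x - 1, p), (x - 1, q)} \<in> Q"
    by metis
  have "(x, p) \<in> \<Union>E" "(x, q) \<in> \<Union>E" using e by blast+
  from this[THEN bspec[OF V]] have "p \<in> G" "q \<in> G" by simp_all
  then have "x - 1 \<le> fst v \<and> snd v \<in> G" if "v \<in> \<Union>Q" for v
    using that[unfolded Q(3)] bspec[OF V, of v] by (elim UnE) auto
  then show "\<exists>Q. extends {v. x \<le> fst v} {(x, p), (x, q)} E Q \<and>
       (\<forall>v\<in>\<Union>Q. x - 1 \<le> fst v \<and> snd v \<in> G) \<and> {(x - 1, p), (x - 1, q)} \<in> Q \<and>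
       card Q = card E + 2 * 1"
    using Q(1,2,4) by (intro exI[of _ Q]) simp
qed

text \<open>Two pushes outward create the longitudinal edge over \<open>p\<close> between the planes
  \<open>x - 2\<close> and \<open>x - 1\<close>, and a third push moves it sideways to
  \<open>w\<close>, which leaves the edge from \<open>p\<close> to \<open>w\<close> in the new end
  plane. One outward push would not do: the sideways push would then need \<open>(x, w)\<close>,
  which may be occupied. In the two fresh planes only \<open>p\<close> and \<open>q\<close> are in
  use. Three pushes cost \<open>2 * 3\<close> edges.\<close>

lemma left_reroute_turn:
  assumes ud: "unit_dist (0, p) (0, w)" and ne: "w \<noteq> q" and w: "w \<in> G"
  shows "left_reroute G p q p w 2 3"
  unfolding left_reroute_def
proof (intro allI impI, elim conjE)
  fix x E
  assume E: "is_polygon E" and V: "\<forall>v\<in>\<Union>E. x \<le> fst v \<and> snd v \<in> G" and e: "{(x, p), (x, q)} \<in> E"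
  have "w \<noteq> p" using ud unit_dist_irrefl by metis
  have "\<Union>E \<subseteq> {v. x \<le> fst v}" using V by blast
  from push_left[OF E this e] obtain Q where
    Q: "extends {v. x \<le> fst v} {(x, p), (x, q)} E Q" "card Q = card E + 2"
      "\<Union>Q = \<Union>E \<union> {(x - 1, p), (x - 1, q)}" "{(x - 1, p), (x - 1, q)} \<in> Q"
    by metis
  have "x - 1 \<le> fst v" if "v \<in> \<Union>Q" for v
    using that[unfolded Q(3)] bspec[OF V, of v] by (elim UnE) auto
  then have "\<Union>Q \<subseteq> {v. x - 1 \<le> fst v}" by blast
  from push_left[OF extends_polygon[OF Q(1)] this Q(4)] obtain R where
    R: "extends {v. x - 1 \<le> fst v} {(x - 1, p), (x - 1, q)} Q R" "card R = card Q + 2"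
      "\<Union>R = \<Union>Q \<union> {(x - 1 - 1, p), (x - 1 - 1, q)}" "{(x - 1, p), (x - 1 - 1, p)} \<in> R"
    by metis
  \<comment> \<open>\<open>push\<close> needs a region containing all vertices of \<open>R\<close>,
    some of which lie to the left of \<open>x\<close>.\<close>
  let ?H = "{v. x \<le> fst v} \<union> \<Union>R"
  have UR: "\<Union>R = \<Union>E \<union> {(x - 1, p), (x - 1, q), (x - 2, p), (x - 2, q)}"
    unfolding R(3) Q(3) by auto
  have e': "{(x - 2, p), (x - 1, p)} \<in> R" using R(4) by (simp add: insert_commute)
  have "(x - 2, w) \<notin> \<Union>E" "(x - 1, w) \<notin> \<Union>E"
    using bspec[OF V, of "(x - 2, w)"] bspec[OF V, of "(x - 1, w)"] by auto
  then have H: "(x - 2, w) \<notin> ?H" "(x - 1, w) \<notin> ?H"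
    unfolding UR using \<open>w \<noteq> p\<close> ne by simp_all
  have uds: "unit_dist (x - 2, p) (x - 2, w)" "unit_dist (x - 1, p) (x - 1, w)"
    "unit_dist (x - 2, w) (x - 1, w)"
    using ud unit_dist_plane[of "x - 2" p w] unit_dist_plane[of "x - 1" p w]
    by (simp_all add: unit_dist_axis)
  define S where "S = R - {{(x - 2, p), (x - 1, p)}} \<union> {{(x - 2, w), (x - 1, w)}} \<union>
    {{(x - 2, p), (x - 2, w)}, {(x - 1, p), (x - 1, w)}}"
  note s = push[OF extends_polygon[OF R(1)] e' Un_upper2 H uds, folded S_def]
  have "extends {v. x \<le> fst v} {(x, p), (x, q)} E R"
    by (rule extends_trans[OF Q(1) R(1)]) auto
  then have "extends {v. x \<le> fst v} {(x, p), (x, q)} E S"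
    by (rule extends_trans[OF _ s(1)]) auto
  moreover have "card S = card E + 2 * 3" using s(2) R(2) Q(2) by simp
  moreover have "{(x - 2, p), (x - 2, w)} \<in> S" unfolding S_def by blast
  moreover have "(x, p) \<in> \<Union>E" "(x, q) \<in> \<Union>E" using e by blast+
  from this[THEN bspec[OF V]] have "p \<in> G" "q \<in> G" by simp_all
  then have "x - 2 \<le> fst v \<and> snd v \<in> G" if "v \<in> \<Union>S" for v
    using that[unfolded s(3) UR] bspec[OF V, of v] w by (elim UnE) auto
  ultimately show "\<exists>Q. extends {v. x \<le> fst v} {(x, p), (x, q)} E Q \<and>
       (\<forall>v\<in>\<Union>Q. x - 2 \<le> fst v \<and> snd v \<in> G) \<and> {(x - 2, p), (x - 2, w)} \<in> Q \<and>
       card Q = card E + 2 * 3"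
    by blast
qed

text \<open>The corner edge is reached by turning about the endpoint nearer to the origin, which
  decreases the coordinate sum.\<close>

lemma left_reroute_corner_aux:
  fixes a b :: nat
  assumes L: "1 \<le> L" and q: "q = (int a + 1, int b) \<or> q = (int a, int b + 1)" and G: "q \<in> grid L M"
  shows "\<exists>m j. 1 \<le> m \<and> left_reroute (grid L M) (int a, int b) q (0, 0) (1, 0) m j"
  using q G
proof (induction "a + b" arbitrary: a b q rule: less_induct)
  case less
  let ?G = "grid L M" and ?p = "(int a, int b)"
  \<comment> \<open>The turn leaves an edge from \<open>?p\<close> to \<open>w\<close>; it is
    swapped because the induction expects the endpoint nearer to the origin first.\<close>
  have via: "\<exists>m j. 1 \<le> m \<and> left_reroute ?G ?p q (0, 0) (1, 0) m j"
    if w: "unit_dist (0, ?p) (0, w)" "w \<noteq> q" "w \<in> ?G"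
      and IH: "\<exists>m j. 1 \<le> m \<and> left_reroute ?G w ?p (0, 0) (1, 0) m j" for w
  proof -
    obtain m j where mj: "1 \<le> m" "left_reroute ?G w ?p (0, 0) (1, 0) m j" using IH by blast
    have "left_reroute ?G ?p q (0, 0) (1, 0) (2 + m) (3 + j)"
      using left_reroute_trans[OF left_reroute_turn[OF w], of "(0, 0)" "(1, 0)" m j] mj
        left_reroute_commute[of ?G w ?p] by simp
    then show ?thesis using mj(1) by (intro exI[of _ "2 + m"] exI[of _ "3 + j"]) simp
  qed
  have pG: "?p \<in> ?G" using less.prems by (auto simp: grid_def)
  consider "a = 0" "b = 0" "q = (1, 0)" | "a = 0" "b = 0" "q = (0, 1)"
    | a' where "a = Suc a'" | b' where "b = Suc b'"
    using less.prems(1) by (cases a; cases b) auto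
  then show ?case
  proof cases
    case 1
    then show ?thesis using left_reroute_straight[of ?G "(0, 0)" "(1, 0)"] by (metis of_nat_0 order_refl)
  next
    case 2
    \<comment> \<open>Only the direction is wrong here. One turn about the origin suffices, and
      \<open>1 \<le> L\<close> provides the vertex \<open>(1, 0)\<close>.\<close>
    have "left_reroute ?G (0, 0) q (0, 0) (1, 0) 2 3"
      using 2 L by (intro left_reroute_turn) (auto simp: grid_def)
    then show ?thesis using 2 by (intro exI[of _ 2] exI[of _ 3]) simp
  next
    case 3
    show ?thesis
    proof (rule via[of "(int a', int b)"])
      show "\<exists>m j. 1 \<le> m \<and> left_reroute ?G (int a', int b) ?p (0, 0) (1, 0) m j"
        by (rule less.hyps) (use 3 pG in auto)
    qed (use 3 pG less.prems in \<open>auto simp: grid_def\<close>)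
  next
    case 4
    show ?thesis
    proof (rule via[of "(int a, int b')"])
      show "\<exists>m j. 1 \<le> m \<and> left_reroute ?G (int a, int b') ?p (0, 0) (1, 0) m j"
        by (rule less.hyps) (use 4 pG in auto)
    qed (use 4 pG less.prems in \<open>auto simp: grid_def\<close>)
  qed
qed

lemma left_reroute_corner:
  assumes "1 \<le> L" "p \<in> grid L M" "q \<in> grid L M" "unit_dist (0, p) (0, q)"
  shows "\<exists>m j. 1 \<le> m \<and> left_reroute (grid L M) p q (0, 0) (1, 0) m j"
proof -
  obtain a b where p: "p = (int a, int b)" using assms(2) by (auto simp: grid_def intro: that[of "nat (fst p)" "nat (snd p)"])
  obtain c d where q: "q = (int c, int d)" using assms(3) by (auto simp: grid_def intro: that[of "nat (fst q)" "nat (snd q)"])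
  have "(int a - int c)\<^sup>2 + (int b - int d)\<^sup>2 = 1" using assms(4) p q by simp
  moreover have "int a \<noteq> int c \<Longrightarrow> (int a - int c)\<^sup>2 \<ge> 1" "int b \<noteq> int d \<Longrightarrow> (int b - int d)\<^sup>2 \<ge> 1"
    by (simp_all add: int_one_le_iff_zero_less)
  ultimately have "(a = c \<and> \<bar>int b - int d\<bar> = 1) \<or> (b = d \<and> \<bar>int a - int c\<bar> = 1)"
    using zero_le_power2[of "int a - int c"] zero_le_power2[of "int b - int d"]
    by (cases "a = c"; cases "b = d") (auto simp: power2_eq_1_iff)
  then consider "q = (int a + 1, int b) \<or> q = (int a, int b + 1)" | "p = (int c + 1, int d) \<or> p = (int c, int d + 1)"
    using p q by fastforce
  then show ?thesis
  proof cases
    case 1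
    then show ?thesis using left_reroute_corner_aux[OF assms(1) 1 assms(3)] p by simp
  next
    case 2
    then show ?thesis using left_reroute_corner_aux[OF assms(1) 2 assms(2)] q left_reroute_commute by metis
  qed
qed

text \<open>Reflection in the plane \<open>x = 0\<close> exchanges the two ends of the tube
  direction and fixes the cross-section.\<close>

lemma left_reroute_imp_right_reroute:
  assumes left: "left_reroute G p q p' q' m j"
  shows "right_reroute G p q p' q' m j"
  unfolding right_reroute_def
proof (intro allI impI, elim conjE)
  fix x E
  assume E: "is_polygon E" and V: "\<forall>v\<in>\<Union>E. fst v \<le> x \<and> snd v \<in> G" and e: "{(x, p), (x, q)} \<in> E"
  let ?E = "(`) reflect ` E"
  have "is_polygon ?E" by (rule polygon_image[OF lattice_embedding_reflect E])
  moreover have "- x \<le> fst (reflect v) \<and> snd (reflect v) \<in> G" if "v \<in> \<Union>E" for v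
    using bspec[OF V that] by auto
  then have "\<forall>v\<in>\<Union>?E. - x \<le> fst v \<and> snd v \<in> G" unfolding Union_image_image by blast
  moreover have "{(- x, p), (- x, q)} \<in> ?E" using imageI[OF e, of "(`) reflect"] by simp
  ultimately
  obtain Q where Q: "extends {v. - x \<le> fst v} {(- x, p), (- x, q)} ?E Q"
       "\<forall>v\<in>\<Union>Q. - x - m \<le> fst v \<and> snd v \<in> G" "{(- x - m, p'), (- x - m, q')} \<in> Q"
       "card Q = card ?E + 2 * j"
    by (rule left_rerouteE[OF left])
  let ?Q = "(`) reflect ` Q"
  have "reflect ` {v. - x \<le> fst v} = {v. fst v \<le> x}"
  proof (intro equalityI subsetI)
    fix v :: vertex assume "v \<in> {v. fst v \<le> x}"
    then show "v \<in> reflect ` {v. - x \<le> fst v}" by (intro image_eqI[of _ _ "reflect v"]) auto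
  qed auto
  then have "extends {v. fst v \<le> x} {(x, p), (x, q)} E ?Q"
    using extends_image[OF lattice_embedding_reflect Q(1)] by (simp add: reflect_image_reflect_image)
  moreover have "fst (reflect v) \<le> x + m \<and> snd (reflect v) \<in> G" if "v \<in> \<Union>Q" for v
    using bspec[OF Q(2) that] by auto
  then have "\<forall>v\<in>\<Union>?Q. fst v \<le> x + m \<and> snd v \<in> G" unfolding Union_image_image by blast
  moreover have "{(x + m, p'), (x + m, q')} \<in> ?Q" using imageI[OF Q(3), of "(`) reflect"] by (simp add: add.commute)
  moreover have "card ?Q = card E + 2 * j"
    using Q(4) card_image_image[OF inj_reflect] by metis
  ultimately show "\<exists>Q. extends {v. fst v \<le> x} {(x, p), (x, q)} E Q \<and>
       (\<forall>v\<in>\<Union>Q. fst v \<le> x + m \<and> snd v \<in> G) \<and> {(x + m, p'), (x + m, q')} \<in> Q \<and>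
       card Q = card E + 2 * j"
    by blast
qed

section \<open>Planes, slabs and the upper bound\<close>

lemma tube_eq: "tube L M = {v. 0 \<le> fst v \<and> snd v \<in> grid L M}"
  by (auto simp: tube_def grid_def)

lemma tube_polygonI:
  assumes "is_polygon E" "\<And>v. v \<in> \<Union>E \<Longrightarrow> 0 \<le> fst v \<and> snd v \<in> grid L M" "v \<in> \<Union>E" "fst v = 0"
  shows "E \<in> tube_polygons L M"
proof -
  have "\<Union>E \<subseteq> tube L M" unfolding tube_eq using assms(2) by blast
  then show ?thesis unfolding tube_polygons_def using assms(1,3,4) by blast
qed

lemma
  assumes "E \<in> tube_polygons L M"
  shows tube_polygon_is_polygon: "is_polygon E"
    and tube_polygon_vertex: "\<And>v. v \<in> \<Union>E \<Longrightarrow> 0 \<le> fst v \<and> snd v \<in> grid L M"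
    and tube_polygon_origin: "\<exists>v\<in>\<Union>E. fst v = 0"
proof -
  show "is_polygon E" "\<exists>v\<in>\<Union>E. fst v = 0" using assms by (simp_all add: tube_polygons_def)
  have "\<Union>E \<subseteq> tube L M" using assms by (simp add: tube_polygons_def)
  then show "0 \<le> fst v \<and> snd v \<in> grid L M" if "v \<in> \<Union>E" for v
    using that unfolding tube_eq by blast
qed

lemma polygon_nonempty:
  assumes P: "is_polygon E"
  shows "\<Union>E \<noteq> {}"
proof -
  obtain e where e: "e \<in> E" using P unfolding is_polygon_def by blast
  obtain u v where "e = {u, v}" by (rule polygon_edgeE[OF P e])
  then show ?thesis using e by blast
qed

lemma polygon_span_ge: "is_polygon E \<Longrightarrow> v \<in> \<Union>E \<Longrightarrow> fst v \<le> polygon_span E"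
  unfolding polygon_span_def by (intro Max_ge finite_imageI polygon_finite_vertices imageI)

lemma polygon_span_attained:
  assumes "is_polygon E"
  obtains v where "v \<in> \<Union>E" "fst v = polygon_span E"
proof -
  have "Max (fst ` \<Union>E) \<in> fst ` \<Union>E"
    using assms by (intro Max_in finite_imageI polygon_finite_vertices) (simp_all only: image_is_empty polygon_nonempty not_False_eq_True)
  then show ?thesis using that unfolding polygon_span_def by (elim imageE) metis
qed

lemma polygon_span_eqI:
  assumes "is_polygon E" "\<And>v. v \<in> \<Union>E \<Longrightarrow> fst v \<le> s" "v \<in> \<Union>E" "fst v = s"
  shows "polygon_span E = s"
  using assms polygon_span_ge[OF assms(1,3)] polygon_span_attained[OF assms(1)] by (metis order_antisym)

lemma tube_polygon_span_nonneg:
  assumes "E \<in> tube_polygons L M"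
  shows "0 \<le> polygon_span E"
  using tube_polygon_origin[OF assms] polygon_span_ge[OF tube_polygon_is_polygon[OF assms]] by metis

lemma lattice_edge_cases:
  assumes "e \<in> lattice_edges"
  obtains x p q where "e = {(x, p), (x, q)}" "p \<noteq> q" | x p where "e = {(x, p), (x + 1, p)}"
proof -
  obtain u v where e: "e = {u, v}" "unit_dist u v" by (rule lattice_edgeE[OF assms])
  obtain x p x' q where uv: "u = (x, p)" "v = (x', q)" by (cases u; cases v)
  consider "x = x'" "p \<noteq> q" | "p = q" "x' = x + 1" | "p = q" "x = x' + 1"
    using unit_dist_cases[OF e(2)] uv by auto
  then show ?thesis using that e(1) uv by cases (auto simp: insert_commute)
qed

text \<open>Every lattice edge of \<open>E\<close> belongs to exactly one slab (if longitudinal) or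
  one hinge (if transversal), so their cardinalities can be added.\<close>

definition slab :: "vertex set set \<Rightarrow> int \<Rightarrow> vertex set set" where
  "slab E i = {e \<in> E. fst ` e = {i, i + 1}}"

definition hinge :: "vertex set set \<Rightarrow> int \<Rightarrow> vertex set set" where
  "hinge E i = {e \<in> E. fst ` e = {i}}"

text \<open>A closed curve crosses a cut an even number of times, and connectedness forces at least
  one crossing. The parity comes from \<open>handshake\<close> for the half-space \<open>C\<close>:
  crossing edges meet it once, all others in 0 or 2 vertices.\<close>

lemma card_slab_ge_2:
  assumes P: "is_polygon E" and u: "u \<in> \<Union>E" "fst u \<le> i" and v: "v \<in> \<Union>E" "i < fst v"
  shows "2 \<le> card (slab E i)"
proof -
  have fin: "finite E" "finite (slab E i)" using polygon_finite[OF P] by (simp_all add: slab_def)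
  have crossing: "{a, b} \<in> slab E i" if "{a, b} \<in> E" "fst a \<le> i" "i < fst b" for a b
  proof -
    have "unit_dist a b" using that(1) P lattice_edge_iff unfolding is_polygon_def by (meson subsetD)
    then have "fst a = i \<and> fst b = i + 1" using unit_dist_cases[of a b] that(2,3) by linarith
    then show ?thesis using that(1) by (simp add: slab_def)
  qed
  have "slab E i \<noteq> {}"
  proof
    assume no: "slab E i = {}"
    have "(u, v) \<in> (adj E)\<^sup>*" using P u(1) v(1) unfolding is_polygon_def connected_edges_def by blast
    then have "fst v \<le> i"
    proof induction
      case base
      then show ?case by (rule u(2))
    next
      case (step b c)
      then show ?case using crossing[of b c] no by force
    qed
    then show False using v(2) by simp
  qed
  define C where "C = {w \<in> \<Union>E. fst w \<le> i}"
  have finC: "finite C" unfolding C_def by (rule finite_subset[OF Collect_subset polygon_finite_vertices[OF P]])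
  have "(\<Sum>e\<in>E. card (e \<inter> C)) = 2 * card C"
  proof (rule handshake[OF fin(1) finC])
    fix v assume "v \<in> C"
    then have "v \<in> \<Union>E" by (simp only: C_def mem_Collect_eq)
    then show "card {e \<in> E. v \<in> e} = 2" by (rule polygon_degree[OF P])
  qed
  moreover have "(\<Sum>e\<in>E. card (e \<inter> C)) = (\<Sum>e\<in>E - slab E i. card (e \<inter> C)) + (\<Sum>e\<in>slab E i. card (e \<inter> C))"
    using fin(1) by (intro sum.subset_diff) (auto simp: slab_def)
  moreover have "(\<Sum>e\<in>slab E i. card (e \<inter> C)) = (\<Sum>e\<in>slab E i. 1)"
  proof (rule sum.cong[OF refl])
    fix e assume e: "e \<in> slab E i"
    then have "e \<in> E" "fst ` e = {i, i + 1}" by (simp_all add: slab_def)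
    obtain a b where ab: "e = {a, b}" "a \<noteq> b" by (rule polygon_edgeE[OF P \<open>e \<in> E\<close>])
    have mem: "w \<in> C \<longleftrightarrow> fst w \<le> i" if "w \<in> e" for w
      using that \<open>e \<in> E\<close> by (auto simp: C_def)
    have "{fst a, fst b} = {i, i + 1}" using \<open>fst ` e = _\<close> ab by simp
    then have "(fst a = i \<and> fst b = i + 1) \<or> (fst a = i + 1 \<and> fst b = i)" by (auto simp: doubleton_eq_iff)
    then have "e \<inter> C = {a} \<or> e \<inter> C = {b}" using mem[of a] mem[of b] ab by auto
    then show "card (e \<inter> C) = 1" by auto
  qed
  moreover have "even (\<Sum>e\<in>E - slab E i. card (e \<inter> C))"
  proof (rule dvd_sum)
    fix e assume e: "e \<in> E - slab E i"
    then have "e \<in> E" by simp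
    obtain a b where ab: "e = {a, b}" "a \<noteq> b" by (rule polygon_edgeE[OF P \<open>e \<in> E\<close>])
    have mem: "w \<in> C \<longleftrightarrow> fst w \<le> i" if "w \<in> e" for w
      using that \<open>e \<in> E\<close> by (auto simp: C_def)
    have "\<not> (fst a \<le> i \<and> i < fst b)" "\<not> (fst b \<le> i \<and> i < fst a)"
      using crossing[of a b] crossing[of b a] e ab by (auto simp: insert_commute)
    then have "e \<inter> C = {a, b} \<or> e \<inter> C = {}" using mem[of a] mem[of b] ab by auto
    then show "even (card (e \<inter> C))" using ab by auto
  qed
  ultimately have "even (card (slab E i))" by simp presburger
  moreover have "card (slab E i) \<noteq> 0" using fin(2) \<open>slab E i \<noteq> {}\<close> by simp
  ultimately show ?thesis by presburger
qed

lemma card_tube_polygon_ge: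
  assumes E: "E \<in> tube_polygons L M"
  shows "2 * nat (polygon_span E) + card {i \<in> {..nat (polygon_span E)}. hinge E (int i) \<noteq> {}} \<le> card E"
proof -
  define s where "s = nat (polygon_span E)"
  define I where "I = {i \<in> {..s}. hinge E (int i) \<noteq> {}}"
  have P: "is_polygon E" by (rule tube_polygon_is_polygon[OF E])
  have s: "int s = polygon_span E" using tube_polygon_span_nonneg[OF E] by (simp add: s_def)
  have fin: "finite E" "finite (slab E i)" "finite (hinge E i)" for i
    using polygon_finite[OF P] by (simp_all add: slab_def hinge_def)
  obtain u where u: "u \<in> \<Union>E" "fst u = 0" using tube_polygon_origin[OF E] by blast
  obtain v where v: "v \<in> \<Union>E" "fst v = int s" using polygon_span_attained[OF P] s by metis
  have finI: "finite I" by (simp add: I_def)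
  have "2 * s = (\<Sum>i<s. 2)" by simp
  also have "\<dots> \<le> (\<Sum>i<s. card (slab E (int i)))"
    by (intro sum_mono card_slab_ge_2[OF P u(1) _ v(1)]) (simp_all add: u v)
  also have "\<dots> = card (\<Union>i<s. slab E (int i))"
  proof (rule card_UN_disjoint[symmetric])
    show "\<forall>i\<in>{..<s}. \<forall>j\<in>{..<s}. i \<noteq> j \<longrightarrow> slab E (int i) \<inter> slab E (int j) = {}"
      by (auto simp: slab_def doubleton_eq_iff)
  qed (simp_all add: fin)
  finally have 1: "2 * s \<le> card (\<Union>i<s. slab E (int i))" .
  have "card I = (\<Sum>i\<in>I. 1)" by simp
  also have "\<dots> \<le> (\<Sum>i\<in>I. card (hinge E (int i)))"
    by (intro sum_mono) (simp add: I_def Suc_le_eq card_gt_0_iff fin)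
  also have "\<dots> = card (\<Union>i\<in>I. hinge E (int i))"
  proof (rule card_UN_disjoint[symmetric])
    show "\<forall>i\<in>I. \<forall>j\<in>I. i \<noteq> j \<longrightarrow> hinge E (int i) \<inter> hinge E (int j) = {}"
      by (auto simp: hinge_def)
  qed (simp_all add: fin finI)
  finally have 2: "card I \<le> card (\<Union>i\<in>I. hinge E (int i))" .
  have "2 * s + card I \<le> card ((\<Union>i<s. slab E (int i)) \<union> (\<Union>i\<in>I. hinge E (int i)))"
  proof (subst card_Un_disjoint)
    show "(\<Union>i<s. slab E (int i)) \<inter> (\<Union>i\<in>I. hinge E (int i)) = {}"
      by (auto simp: slab_def hinge_def)
  qed (use 1 2 fin finI in simp_all)
  also have "\<dots> \<le> card E"
    by (intro card_mono fin(1)) (auto simp: slab_def hinge_def)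
  finally show ?thesis by (simp add: I_def s_def)
qed

section \<open>The partition function as a finite sum over polygons\<close>

definition tube_polygons_of_length :: "nat \<Rightarrow> nat \<Rightarrow> nat \<Rightarrow> vertex set set set" where
  "tube_polygons_of_length L M n = {E \<in> tube_polygons L M. card E = n}"

lemma span_le_length: "E \<in> tube_polygons_of_length L M n \<Longrightarrow> 2 * nat (polygon_span E) \<le> n"
  using card_tube_polygon_ge unfolding tube_polygons_of_length_def by fastforce

lemma finite_grid: "finite (grid L M)"
  by (simp add: grid_def)

lemma finite_tube_polygons_of_length: "finite (tube_polygons_of_length L M n)"
proof (rule finite_subset)
  show "tube_polygons_of_length L M n \<subseteq> Pow (Pow ({0..int n} \<times> grid L M))"
  proof (intro subsetI PowI)
    fix E e v assume E: "E \<in> tube_polygons_of_length L M n" and "e \<in> E" "v \<in> e"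
    then have T: "E \<in> tube_polygons L M" and v: "v \<in> \<Union>E"
      by (auto simp: tube_polygons_of_length_def)
    have "fst v \<le> int n"
      using polygon_span_ge[OF tube_polygon_is_polygon[OF T] v] span_le_length[OF E] by linarith
    then show "v \<in> {0..int n} \<times> grid L M"
      using tube_polygon_vertex[OF T v] by (simp add: mem_Times_iff)
  qed
qed (simp add: finite_grid)

text \<open>In this form injections between sets of polygons yield inequalities between partition
  functions. The series terminates because spans beyond \<open>n\<close> do not occur.\<close>

lemma partition_function_eq:
  "partition_function L M n f = (\<Sum>E\<in>tube_polygons_of_length L M n. exp (f * real_of_int (polygon_span E)))"
proof -
  let ?P = "tube_polygons_of_length L M n"
  have num: "num_polygons L M n s = card {E \<in> ?P. nat (polygon_span E) = s}" for s
    unfolding num_polygons_def tube_polygons_of_length_def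
    by (rule arg_cong[where f = card]) (use tube_polygon_span_nonneg in fastforce)
  have "partition_function L M n f = (\<Sum>s\<in>{..n}. real (num_polygons L M n s) * exp (f * real s))"
    unfolding partition_function_def
  proof (rule suminf_finite)
    fix s assume "s \<notin> {..n}"
    then have "{E \<in> ?P. nat (polygon_span E) = s} = {}" using span_le_length by fastforce
    then have "num_polygons L M n s = 0" unfolding num by (simp only: card.empty)
    then show "real (num_polygons L M n s) * exp (f * real s) = 0" by simp
  qed simp
  also have "\<dots> = (\<Sum>s\<in>{..n}. \<Sum>E\<in>{E \<in> ?P. nat (polygon_span E) = s}. exp (f * real_of_int (polygon_span E)))"
  proof (rule sum.cong[OF refl])
    fix s
    have "(\<Sum>E\<in>{E \<in> ?P. nat (polygon_span E) = s}. exp (f * real_of_int (polygon_span E))) =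
        (\<Sum>E\<in>{E \<in> ?P. nat (polygon_span E) = s}. exp (f * real s))"
      by (rule sum.cong[OF refl]) (auto simp: tube_polygons_of_length_def dest: tube_polygon_span_nonneg)
    then show "real (num_polygons L M n s) * exp (f * real s) =
        (\<Sum>E\<in>{E \<in> ?P. nat (polygon_span E) = s}. exp (f * real_of_int (polygon_span E)))"
      unfolding num by simp
  qed
  also have "\<dots> = (\<Sum>E\<in>?P. exp (f * real_of_int (polygon_span E)))"
    by (rule sum.group) (use finite_tube_polygons_of_length span_le_length in fastforce)+
  finally show ?thesis .
qed

section \<open>Encoding a polygon plane by plane\<close>

definition column :: "vertex set set \<Rightarrow> int \<Rightarrow> (int \<times> int) set" where
  "column E i = {p. {(i, p), (i + 1, p)} \<in> E}"

text \<open>Without transversal edges only the two longitudinal edges are available at the vertex,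
  and degree 2 uses both.\<close>

lemma straight_of_hinge_empty:
  assumes P: "is_polygon E" and H: "hinge E i = {}" and V: "(i, p) \<in> \<Union>E"
  shows "{(i, p), (i + 1, p)} \<in> E" and "{(i - 1, p), (i, p)} \<in> E"
proof -
  have sub: "{e \<in> E. (i, p) \<in> e} \<subseteq> {{(i, p), (i + 1, p)}, {(i - 1, p), (i, p)}}"
  proof
    fix e assume e: "e \<in> {e \<in> E. (i, p) \<in> e}"
    then have "e \<in> lattice_edges" using P unfolding is_polygon_def by blast
    then show "e \<in> {{(i, p), (i + 1, p)}, {(i - 1, p), (i, p)}}"
    proof (cases rule: lattice_edge_cases)
      case (1 x q r)
      then have "e \<in> hinge E i" using e by (auto simp: hinge_def)
      then show ?thesis using H by simp
    next
      case (2 x q)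
      then show ?thesis using e by auto
    qed
  qed
  have "card {e \<in> E. (i, p) \<in> e} = 2" by (rule polygon_degree[OF P V])
  moreover have "card {{(i, p), (i + 1, p)}, {(i - 1, p), (i, p)}} = 2"
    by (simp add: doubleton_eq_iff)
  ultimately have "{e \<in> E. (i, p) \<in> e} = {{(i, p), (i + 1, p)}, {(i - 1, p), (i, p)}}"
    by (intro card_subset_eq sub) simp_all
  then show "{(i, p), (i + 1, p)} \<in> E" "{(i - 1, p), (i, p)} \<in> E" by blast+
qed

lemma column_eq_of_hinge_empty:
  assumes P: "is_polygon E" and H: "hinge E i = {}"
  shows "column E i = column E (i - 1)"
proof (intro equalityI subsetI)
  fix p assume "p \<in> column E i"
  then have "(i, p) \<in> \<Union>E" by (auto simp: column_def)
  from straight_of_hinge_empty(2)[OF P H this] show "p \<in> column E (i - 1)" by (simp add: column_def)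
next
  fix p assume "p \<in> column E (i - 1)"
  then have "(i, p) \<in> \<Union>E" by (auto simp: column_def)
  from straight_of_hinge_empty(1)[OF P H this] show "p \<in> column E i" by (simp add: column_def)
qed

text \<open>A plane without edges of the polygon carries no information, since it copies the previous
  slab; this is what makes straight polygons few.\<close>

definition plane_code :: "vertex set set \<Rightarrow> int \<Rightarrow> ((int \<times> int) set set \<times> (int \<times> int) set) option" where
  "plane_code E i = (if hinge E i = {} then None else Some ((`) snd ` hinge E i, column E i))"

text \<open>Transversal edges are read off the codes directly; columns are recovered from left to
  right, a plane coded \<open>None\<close> passing on the previous column. One inclusion is enough
  since the roles can be exchanged.\<close>

lemma tube_polygon_subset_of_plane_code_eq:
  assumes E: "E \<in> tube_polygons L M" and E': "E' \<in> tube_polygons L M"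
    and s: "polygon_span E = int s"
    and code: "\<And>i. i \<le> s \<Longrightarrow> plane_code E (int i) = plane_code E' (int i)"
  shows "E \<subseteq> E'"
proof -
  note P = tube_polygon_is_polygon[OF E] and P' = tube_polygon_is_polygon[OF E']
  have hinges: "(`) snd ` hinge E (int i) = (`) snd ` hinge E' (int i)" if "i \<le> s" for i
    using code[OF that] by (simp add: plane_code_def split: if_splits)
  have columns: "column E (int i) = column E' (int i)" if "i \<le> s" for i
    using that
  proof (induction i)
    case 0
    \<comment> \<open>Starting value of the propagation: the tube has no vertex with negative first
      coordinate.\<close>
    have "column F (int 0 - 1) = {}" if "F \<in> tube_polygons L M" for F
    proof -
      have False if "p \<in> column F (int 0 - 1)" for p
        using that tube_polygon_vertex[OF \<open>F \<in> _\<close>, of "(- 1, p)"] by (auto simp: column_def)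
      then show ?thesis by blast
    qed
    then show ?case
      using code[OF 0] column_eq_of_hinge_empty[OF P, of "int 0"] column_eq_of_hinge_empty[OF P', of "int 0"] E E'
      by (simp only: plane_code_def split: if_splits) simp_all
  next
    case (Suc i)
    then have "column E (int (Suc i) - 1) = column E' (int (Suc i) - 1)" by simp
    then show ?case
      using code[OF Suc.prems] column_eq_of_hinge_empty[OF P, of "int (Suc i)"]
        column_eq_of_hinge_empty[OF P', of "int (Suc i)"]
      by (simp only: plane_code_def split: if_splits) simp_all
  qed
  have range: "\<exists>i\<le>s. x = int i" if "(x, p) \<in> \<Union>E" for x p
    using tube_polygon_vertex[OF E that] polygon_span_ge[OF P that] s
    by (intro exI[of _ "nat x"]) auto
  show "E \<subseteq> E'"
  proof
    fix e assume e: "e \<in> E"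
    then have "e \<in> lattice_edges" using P unfolding is_polygon_def by blast
    then show "e \<in> E'"
    proof (cases rule: lattice_edge_cases)
      case (1 x p q)
      have "(x, p) \<in> \<Union>E" using e 1 by blast
      then obtain i where i: "i \<le> s" "x = int i" using range by blast
      have "e \<in> hinge E (int i)" using e 1 i by (simp add: hinge_def)
      then have "snd ` e \<in> (`) snd ` hinge E' (int i)" using hinges[OF i(1)] by blast
      then obtain e' where e': "e' \<in> hinge E' (int i)" "snd ` e = snd ` e'" by (elim imageE)
      \<comment> \<open>A transversal edge is determined by its plane and its projection, so
        comparing projections of hinges loses nothing.\<close>
      have planar: "d = Pair (int i) ` snd ` d" if "fst ` d = {int i}" for d :: "vertex set"
      proof -
        have "Pair (int i) (snd v) = v" if "v \<in> d" for v
          using imageI[OF that, of fst] \<open>fst ` d = {int i}\<close> by (cases v) simp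
        then show ?thesis by (simp add: image_image)
      qed
      have "e = e'"
        using planar[of e] planar[of e'] e' \<open>e \<in> hinge E (int i)\<close> by (simp add: hinge_def)
      then show ?thesis using e' by (simp add: hinge_def)
    next
      case (2 x p)
      have "(x, p) \<in> \<Union>E" using e 2 by blast
      then obtain i where i: "i \<le> s" "x = int i" using range by blast
      have "p \<in> column E (int i)" using e 2 i by (simp add: column_def)
      then have "p \<in> column E' (int i)" using columns[OF i(1)] by simp
      then show ?thesis using 2 i by (simp add: column_def)
    qed
  qed
qed


text \<open>A crude superset of the contents a plane can have; its size depends on \<open>L\<close>
  and \<open>M\<close> alone.\<close>

definition plane_codes :: "nat \<Rightarrow> nat \<Rightarrow> ((int \<times> int) set set \<times> (int \<times> int) set) set" where
  "plane_codes L M = Pow (Pow (grid L M)) \<times> Pow (grid L M)"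

lemma finite_plane_codes: "finite (plane_codes L M)"
  by (simp add: plane_codes_def finite_grid)

lemma plane_code_mem:
  assumes "E \<in> tube_polygons L M"
  shows "plane_code E i \<in> insert None (Some ` plane_codes L M)"
proof -
  have G: "snd v \<in> grid L M" if "v \<in> e" "e \<in> E" for v e
    using tube_polygon_vertex[OF assms, of v] that by blast
  have "(`) snd ` hinge E i \<in> Pow (Pow (grid L M))" using G by (auto simp: hinge_def)
  moreover have "column E i \<subseteq> grid L M"
  proof
    fix p assume "p \<in> column E i"
    then show "p \<in> grid L M" using G[of "(i, p)" "{(i, p), (i + 1, p)}"] by (simp add: column_def)
  qed
  ultimately show ?thesis by (simp add: plane_code_def plane_codes_def)
qed

text \<open>The codes embed the polygons of span \<open>s\<close> into all words of length
  \<open>s + 1\<close>, where the symbol \<open>None\<close> weighs 1 and every other symbol weighs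
  \<open>t\<close>. Over all words the sum of products factorises; words that encode no polygon only
  enlarge it.\<close>

lemma sum_power_card_hinges_le:
  fixes t :: real
  assumes t: "0 \<le> t"
  shows "(\<Sum>E\<in>{E \<in> tube_polygons_of_length L M n. nat (polygon_span E) = s}.
      t ^ card {i \<in> {..s}. hinge E (int i) \<noteq> {}}) \<le> (1 + real (card (plane_codes L M)) * t) ^ Suc s"
proof -
  let ?X = "{E \<in> tube_polygons_of_length L M n. nat (polygon_span E) = s}"
  let ?\<Omega> = "insert None (Some ` plane_codes L M)"
  define w :: "((int \<times> int) set set \<times> (int \<times> int) set) option \<Rightarrow> real"
    where "w c = (if c = None then 1 else t)" for c
  \<comment> \<open>Restriction makes equal codes equal functions and puts them into
    \<open>PiE\<close>, over which the sum factorises.\<close>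
  define code where "code E = restrict (\<lambda>i. plane_code E (int i)) {..s}" for E
  have X: "E \<in> tube_polygons L M" "polygon_span E = int s" if "E \<in> ?X" for E
    using that tube_polygon_span_nonneg[of E L M] by (auto simp: tube_polygons_of_length_def)
  have inj: "inj_on code ?X"
  proof (rule inj_onI)
    fix E E' assume E: "E \<in> ?X" and E': "E' \<in> ?X" and eq: "code E = code E'"
    have c: "plane_code E (int i) = plane_code E' (int i)" if "i \<le> s" for i
      using fun_cong[OF eq, of i] that by (simp add: code_def)
    show "E = E'"
      using tube_polygon_subset_of_plane_code_eq[OF X(1)[OF E] X(1)[OF E'] X(2)[OF E] c]
        tube_polygon_subset_of_plane_code_eq[OF X(1)[OF E'] X(1)[OF E] X(2)[OF E'] c[symmetric]]
      by (rule equalityI)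
  qed
  have "t ^ card {i \<in> {..s}. hinge E (int i) \<noteq> {}} = (\<Prod>i\<in>{..s}. w (code E i))" for E
  proof -
    have "(\<Prod>i\<in>{..s}. w (code E i)) = (\<Prod>i\<in>{..s}. if hinge E (int i) \<noteq> {} then t else 1)"
      by (rule prod.cong) (auto simp: w_def code_def plane_code_def)
    also have "\<dots> = (\<Prod>i\<in>{i \<in> {..s}. hinge E (int i) \<noteq> {}}. t)"
      by (rule prod.inter_filter[symmetric]) simp
    finally show ?thesis by simp
  qed
  then have "(\<Sum>E\<in>?X. t ^ card {i \<in> {..s}. hinge E (int i) \<noteq> {}}) = (\<Sum>g\<in>code ` ?X. \<Prod>i\<in>{..s}. w (g i))"
    by (simp add: sum.reindex[OF inj])
  also have "\<dots> \<le> (\<Sum>g\<in>PiE {..s} (\<lambda>_. ?\<Omega>). \<Prod>i\<in>{..s}. w (g i))"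
  proof (rule sum_mono2)
    show "finite (PiE {..s} (\<lambda>_. ?\<Omega>))" by (intro finite_PiE) (simp_all add: finite_plane_codes)
    show "code ` ?X \<subseteq> PiE {..s} (\<lambda>_. ?\<Omega>)"
    proof
      fix g assume "g \<in> code ` ?X"
      then obtain E where "g = code E" "E \<in> ?X" by (elim imageE)
      then show "g \<in> PiE {..s} (\<lambda>_. ?\<Omega>)"
        using plane_code_mem[OF X(1)] by (simp only: code_def restrict_PiE_iff) blast
    qed
    show "0 \<le> (\<Prod>i\<in>{..s}. w (g i))" for g by (rule prod_nonneg) (simp add: w_def t)
  qed
  also have "\<dots> = (\<Prod>i\<in>{..s}. \<Sum>c\<in>?\<Omega>. w c)"
    by (rule prod_sum_PiE[symmetric]) (simp_all add: finite_plane_codes)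
  also have "(\<Sum>c\<in>?\<Omega>. w c) = 1 + real (card (plane_codes L M)) * t"
    by (subst sum.insert) (auto simp: finite_plane_codes w_def sum.reindex)
  finally show ?thesis by simp
qed

text \<open>With \<open>t = exp (- f / 2)\<close> the weight of a polygon is
  \<open>exp (f * real k)\<close> times \<open>t\<close> to the power of its excess, and
  \<open>0 \<le> f\<close> allows the excess to be replaced by the number of planes with an edge.
  The factor \<open>Suc k\<close> counts the possible spans and is subexponential.\<close>

lemma partition_function_le:
  assumes f: "0 \<le> f"
  shows "partition_function L M (2 * k) f \<le>
    exp (f * real k) * (real (Suc k) * (1 + real (card (plane_codes L M)) * exp (- f / 2)) ^ Suc k)"
proof -
  let ?P = "tube_polygons_of_length L M (2 * k)"
  define t where "t = exp (- f / 2)"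
  define B where "B = 1 + real (card (plane_codes L M)) * t"
  define h where "h E = card {i \<in> {..nat (polygon_span E)}. hinge E (int i) \<noteq> {}}" for E
  have t: "0 \<le> t" "t \<le> 1" using f by (simp_all add: t_def)
  have B: "1 \<le> B" using t by (simp add: B_def)
  have exp_le: "exp (f * real_of_int (polygon_span E)) \<le> exp (f * real k) * t ^ h E" if E: "E \<in> ?P" for E
  proof -
    have T: "E \<in> tube_polygons L M" "card E = 2 * k" using E by (simp_all add: tube_polygons_of_length_def)
    define s where "s = nat (polygon_span E)"
    have s: "polygon_span E = int s" using tube_polygon_span_nonneg[OF T(1)] by (simp add: s_def)
    have le: "2 * s + h E \<le> 2 * k" using card_tube_polygon_ge[OF T(1)] T(2) by (simp add: h_def s_def)
    then have "real k - real s = real (2 * k - 2 * s) / 2" by (simp add: of_nat_diff)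
    then have "exp (f * real s) = exp (f * real k) * t ^ (2 * k - 2 * s)"
      unfolding t_def exp_of_nat_mult[symmetric] exp_add[symmetric] using le
      by (simp add: of_nat_diff field_simps)
    also have "t ^ (2 * k - 2 * s) \<le> t ^ h E" using t le by (intro power_decreasing) auto
    finally show ?thesis using s by simp
  qed
  have "partition_function L M (2 * k) f \<le> (\<Sum>E\<in>?P. exp (f * real k) * t ^ h E)"
    unfolding partition_function_eq by (rule sum_mono) (rule exp_le)
  also have "\<dots> = exp (f * real k) * (\<Sum>E\<in>?P. t ^ h E)" by (simp add: sum_distrib_left)
  also have "(\<Sum>E\<in>?P. t ^ h E) = (\<Sum>s\<in>{..k}. \<Sum>E\<in>{E \<in> ?P. nat (polygon_span E) = s}. t ^ h E)"
    by (rule sum.group[symmetric]) (use finite_tube_polygons_of_length span_le_length in fastforce)+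
  also have "\<dots> \<le> (\<Sum>s\<in>{..k}. B ^ Suc k)"
  proof (rule sum_mono)
    fix s assume "s \<in> {..k}"
    have "(\<Sum>E\<in>{E \<in> ?P. nat (polygon_span E) = s}. t ^ h E) \<le> B ^ Suc s"
      unfolding B_def using sum_power_card_hinges_le[OF t(1), where L = L and M = M and n = "2 * k" and s = s]
      by (simp add: h_def cong: conj_cong)
    also have "\<dots> \<le> B ^ Suc k" using B \<open>s \<in> {..k}\<close> by (intro power_increasing) auto
    finally show "(\<Sum>E\<in>{E \<in> ?P. nat (polygon_span E) = s}. t ^ h E) \<le> B ^ Suc k" .
  qed
  also have "\<dots> = real (Suc k) * B ^ Suc k" by simp
  finally show ?thesis by (simp add: B_def t_def)
qed

section \<open>Polygons capped by corner edges\<close>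

abbreviation corner :: "int \<Rightarrow> vertex set" where
  "corner x \<equiv> {(x, 0, 0), (x, 1, 0)}"

text \<open>A span of at least 1 keeps the two caps distinct, so that one can be opened while the
  other stays.\<close>

definition capped_polygons :: "nat \<Rightarrow> nat \<Rightarrow> nat \<Rightarrow> vertex set set set" where
  "capped_polygons L M n = {E \<in> tube_polygons_of_length L M n.
     1 \<le> polygon_span E \<and> corner 0 \<in> E \<and> corner (polygon_span E) \<in> E}"

definition capped_partition :: "nat \<Rightarrow> nat \<Rightarrow> nat \<Rightarrow> real \<Rightarrow> real" where
  "capped_partition L M n f = (\<Sum>E\<in>capped_polygons L M n. exp (f * real_of_int (polygon_span E)))"

lemma finite_capped_polygons: "finite (capped_polygons L M n)"
  unfolding capped_polygons_def by (rule finite_subset[OF Collect_subset finite_tube_polygons_of_length])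

lemma
  assumes "E \<in> capped_polygons L M n"
  shows capped_tube: "E \<in> tube_polygons L M" and capped_card: "card E = n"
    and capped_span: "1 \<le> polygon_span E" and capped_left: "corner 0 \<in> E"
    and capped_right: "corner (polygon_span E) \<in> E" and capped_polygon: "is_polygon E"
  using assms tube_polygon_is_polygon
  by (auto simp: capped_polygons_def tube_polygons_of_length_def)

lemma cappedI:
  assumes P: "is_polygon E" and V: "\<And>v. v \<in> \<Union>E \<Longrightarrow> 0 \<le> fst v \<and> fst v \<le> s \<and> snd v \<in> grid L M"
    and s: "1 \<le> s" and c: "corner 0 \<in> E" "corner s \<in> E" and n: "card E = n"
  shows "E \<in> capped_polygons L M n" and "polygon_span E = s"
proof -
  have v: "(0, 0, 0) \<in> \<Union>E" "(s, 0, 0) \<in> \<Union>E" using c by blast+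
  show span: "polygon_span E = s" by (rule polygon_span_eqI[OF P _ v(2)]) (use V in simp_all)
  have "E \<in> tube_polygons L M" by (rule tube_polygonI[OF P _ v(1)]) (use V in simp_all)
  then show "E \<in> capped_polygons L M n"
    unfolding capped_polygons_def tube_polygons_of_length_def using span s c n by simp
qed

lemma extends_recover: "extends H e E Q \<Longrightarrow> e \<in> E \<Longrightarrow> E = insert e {f \<in> Q. f \<subseteq> H}"
  using extends_edges[of H e E Q] by blast

text \<open>A choice of \<open>(i, y)\<close> for each \<open>x\<close> is automatically injective
  because \<open>g\<close> decodes it. The finite index \<open>i\<close> holds the information that
  the image \<open>y\<close> alone does not.\<close>

lemma sum_le_sum_of_recover:
  fixes w :: "'a \<Rightarrow> real"
  assumes I: "finite I" and Y: "\<And>i. i \<in> I \<Longrightarrow> finite (Y i)"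
    and w': "\<And>i y. i \<in> I \<Longrightarrow> y \<in> Y i \<Longrightarrow> 0 \<le> w' y"
    and ex: "\<And>x. x \<in> X \<Longrightarrow> \<exists>i\<in>I. \<exists>y\<in>Y i. x = g i y \<and> w x \<le> w' y"
  shows "sum w X \<le> (\<Sum>i\<in>I. sum w' (Y i))"
proof -
  define P where "P x iy \<longleftrightarrow> fst iy \<in> I \<and> snd iy \<in> Y (fst iy) \<and> x = g (fst iy) (snd iy) \<and> w x \<le> w' (snd iy)"
    for x iy
  have "\<exists>iy. P x iy" if "x \<in> X" for x using ex[OF that] by (auto simp: P_def)
  then obtain h where h: "\<And>x. x \<in> X \<Longrightarrow> P x (h x)" by metis
  have inj: "inj_on h X" using h by (intro inj_onI) (metis P_def)
  have "sum w X \<le> (\<Sum>x\<in>X. w' (snd (h x)))" using h by (intro sum_mono) (simp add: P_def)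
  also have "\<dots> = (\<Sum>iy\<in>h ` X. w' (snd iy))" by (simp add: sum.reindex[OF inj])
  also have "\<dots> \<le> (\<Sum>iy\<in>Sigma I Y. w' (snd iy))"
  proof (rule sum_mono2)
    show "finite (Sigma I Y)" using I Y by (rule finite_SigmaI)
    show "h ` X \<subseteq> Sigma I Y"
    proof
      fix iy assume "iy \<in> h ` X"
      then obtain x where "x \<in> X" "iy = h x" by blast
      then show "iy \<in> Sigma I Y" using h[of x] SigmaI[of "fst (h x)" I "snd (h x)" Y] by (simp add: P_def)
    qed
  qed (use w' in auto)
  also have "\<dots> = (\<Sum>i\<in>I. sum w' (Y i))"
    using I Y by (subst sum.Sigma) (auto simp: case_prod_beta)
  finally show ?thesis .
qed

section \<open>From arbitrary polygons to capped ones\<close>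

lemma plane_edge_of_hinge:
  assumes P: "is_polygon E" and H: "hinge E x \<noteq> {}"
  obtains p q where "{(x, p), (x, q)} \<in> E" "unit_dist (0, p) (0, q)"
proof -
  obtain e where e: "e \<in> E" "fst ` e = {x}" using H unfolding hinge_def by blast
  then have lat: "e \<in> lattice_edges" using P unfolding is_polygon_def by blast
  then show ?thesis
  proof (cases rule: lattice_edge_cases)
    case (1 y p q)
    then have "y = x" using e by auto
    then show ?thesis using that[of p q] e lat 1 unit_dist_plane[of x p q] lattice_edge_iff by metis
  next
    case (2 y p)
    then show ?thesis using e by auto
  qed
qed

text \<open>Otherwise the polygon would pass straight through the plane and reach vertices on both
  sides of it.\<close>

lemma hinge_nonempty_extremal:
  assumes P: "is_polygon E" and V: "v \<in> \<Union>E" "fst v = x"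
    and ex: "(\<forall>v\<in>\<Union>E. x \<le> fst v) \<or> (\<forall>v\<in>\<Union>E. fst v \<le> x)"
  shows "hinge E x \<noteq> {}"
proof
  assume H: "hinge E x = {}"
  have "(x, snd v) \<in> \<Union>E" using V by (metis prod.collapse)
  from straight_of_hinge_empty[OF P H this]
  have out: "(x + 1, snd v) \<in> \<Union>E" "(x - 1, snd v) \<in> \<Union>E" by blast+
  from ex show False
  proof
    assume "\<forall>v\<in>\<Union>E. x \<le> fst v"
    from bspec[OF this out(2)] show False by simp
  next
    assume "\<forall>v\<in>\<Union>E. fst v \<le> x"
    from bspec[OF this out(1)] show False by simp
  qed
qed

text \<open>Caps the right end of a polygon whose left cap already sits at \<open>- a\<close>, then
  shifts that cap to the plane 0. It serves general polygons, with \<open>a\<close> the depth of the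
  left rerouting, and capped ones, with \<open>a = 0\<close>.\<close>

lemma extend_right:
  assumes r: "right_reroute (grid L M) p q (0, 0) (1, 0) m j" and m: "1 \<le> m" and s: "1 \<le> s + a" "0 \<le> s"
    and P: "is_polygon E" and V: "\<And>v. v \<in> \<Union>E \<Longrightarrow> - a \<le> fst v \<and> fst v \<le> s \<and> snd v \<in> grid L M"
    and c: "corner (- a) \<in> E" and e: "{(s, p), (s, q)} \<in> E"
  obtains R where "extends {v. fst v \<le> s} {(s, p), (s, q)} E R"
    "(`) (shift a) ` R \<in> capped_polygons L M (card E + 2 * j)"
    "polygon_span ((`) (shift a) ` R) = s + m + a"
proof -
  have V': "\<forall>v\<in>\<Union>E. fst v \<le> s \<and> snd v \<in> grid L M" using V by blast
  obtain R where R: "extends {v. fst v \<le> s} {(s, p), (s, q)} E R"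
    "\<forall>v\<in>\<Union>R. fst v \<le> s + m \<and> snd v \<in> grid L M" "corner (s + m) \<in> R" "card R = card E + 2 * j"
    by (rule right_rerouteE[OF r P V' e])
  let ?R = "(`) (shift a) ` R"
  \<comment> \<open>\<open>- a < s\<close>, so the left cap is not the edge being rerouted.\<close>
  have "corner (- a) \<in> E - {{(s, p), (s, q)}}" using c s by (auto simp: doubleton_eq_iff)
  then have "corner (- a) \<in> {f \<in> R. f \<subseteq> {v. fst v \<le> s}}" using extends_edges[OF R(1)] by simp
  then have "corner (- a) \<in> R" by blast
  then have cl: "corner 0 \<in> ?R" using imageI[of "corner (- a)" R "(`) (shift a)"] by simp
  have cr: "corner (s + m + a) \<in> ?R" using imageI[OF R(3), of "(`) (shift a)"] by simp
  have "0 \<le> fst (shift a v) \<and> fst (shift a v) \<le> s + m + a \<and> snd (shift a v) \<in> grid L M" if "v \<in> \<Union>R" for v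
  proof (cases "fst v \<le> s")
    case True
    then have "v \<in> \<Union>E" using that extends_new_vertices[OF R(1)] by blast
    then show ?thesis using V[of v] bspec[OF R(2) that] by simp
  next
    case False
    then show ?thesis using bspec[OF R(2) that] s by simp
  qed
  then have VR: "0 \<le> fst v \<and> fst v \<le> s + m + a \<and> snd v \<in> grid L M" if "v \<in> \<Union>?R" for v
    using that unfolding Union_image_image by (elim imageE) (simp only:)
  have n: "card ?R = card E + 2 * j" using R(4) card_image_image[OF inj_shift] by metis
  have PR: "is_polygon ?R" by (rule polygon_image[OF lattice_embedding_shift extends_polygon[OF R(1)]])
  have sm: "1 \<le> s + m + a" using m s by simp
  show ?thesis
    by (rule that[OF R(1) cappedI[OF PR VR sm cl cr n]])
qed

lemma capped_extend:
  assumes E: "E \<in> capped_polygons L M n"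
  obtains R where "R \<in> capped_polygons L M (n + 2)" "polygon_span R = polygon_span E + 1"
    "E = insert (corner (polygon_span E)) {f \<in> R. f \<subseteq> {v. fst v \<le> polygon_span E}}"
proof -
  let ?s = "polygon_span E"
  note T = capped_tube[OF E] and P = capped_polygon[OF E] and s = capped_span[OF E]
  have V: "- 0 \<le> fst v \<and> fst v \<le> ?s \<and> snd v \<in> grid L M" if "v \<in> \<Union>E" for v
    using tube_polygon_vertex[OF T that] polygon_span_ge[OF P that] by simp
  have r: "right_reroute (grid L M) (0, 0) (1, 0) (0, 0) (1, 0) 1 1"
    by (rule left_reroute_imp_right_reroute[OF left_reroute_straight])
  obtain R where R: "extends {v. fst v \<le> ?s} (corner ?s) E R"
    "(`) (shift 0) ` R \<in> capped_polygons L M (card E + 2 * 1)"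
    "polygon_span ((`) (shift 0) ` R) = ?s + 1 + 0"
    by (rule extend_right[OF r _ _ _ P V _ capped_right[OF E]]) (use s capped_left[OF E] in simp_all)
  show ?thesis
    by (rule that[of R]) (use R(2,3) extends_recover[OF R(1) capped_right[OF E]] capped_card[OF E] in
      \<open>simp_all add: shift_image_0\<close>)
qed

text \<open>Pushing the right cap one plane further adds two edges and one unit of span, and cutting
  off the last plane undoes it. There is nothing to remember, hence the index set
  \<open>{()}\<close>.\<close>

lemma capped_partition_mono:
  assumes f: "0 \<le> f"
  shows "capped_partition L M n f \<le> capped_partition L M (n + 2) f"
proof -
  have "capped_partition L M n f \<le>
      (\<Sum>i\<in>{()}. \<Sum>E\<in>capped_polygons L M (n + 2). exp (f * real_of_int (polygon_span E)))"
    unfolding capped_partition_def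
  proof (rule sum_le_sum_of_recover[where g = "\<lambda>_ R. insert (corner (polygon_span R - 1))
        {e \<in> R. e \<subseteq> {v. fst v \<le> polygon_span R - 1}}"])
    fix E assume "E \<in> capped_polygons L M n"
    then obtain R where R: "R \<in> capped_polygons L M (n + 2)" "polygon_span R = polygon_span E + 1"
      "E = insert (corner (polygon_span E)) {f \<in> R. f \<subseteq> {v. fst v \<le> polygon_span E}}"
      by (rule capped_extend)
    have "exp (f * real_of_int (polygon_span E)) \<le> exp (f * real_of_int (polygon_span R))"
      using f R(2) by (simp add: mult_left_mono)
    then show "\<exists>i\<in>{()}. \<exists>R\<in>capped_polygons L M (n + 2). E = insert (corner (polygon_span R - 1))
        {e \<in> R. e \<subseteq> {v. fst v \<le> polygon_span R - 1}} \<and>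
        exp (f * real_of_int (polygon_span E)) \<le> exp (f * real_of_int (polygon_span R))"
      using R by (intro bexI[of _ "()"] bexI[of _ R]) simp_all
  qed (simp_all add: finite_capped_polygons)
  then show ?thesis by (simp add: capped_partition_def)
qed

text \<open>Both ends are rerouted to the corner, the left one first. The index records the two
  rerouted edges, and weights do not drop because the span grows. \<open>N\<close> and
  \<open>j\<close> are independent of \<open>n\<close> and \<open>f\<close>, so they do not affect
  the growth rate.\<close>

lemma partition_function_le_capped:
  assumes L: "1 \<le> L"
  obtains N j where "\<And>n f. 0 \<le> f \<Longrightarrow>
    partition_function L M n f \<le> real N * capped_partition L M (n + 2 * j) f"
proof -
  let ?G = "grid L M"
  define A where "A = {pq \<in> ?G \<times> ?G. unit_dist (0, fst pq) (0, snd pq)}"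
  have finA: "finite A" unfolding A_def by (rule finite_subset[OF Collect_subset]) (simp add: finite_grid)
  define reroutes where "reroutes pq mj \<longleftrightarrow>
    1 \<le> fst mj \<and> left_reroute ?G (fst pq) (snd pq) (0, 0) (1, 0) (fst mj) (snd mj)" for pq mj
  have "\<exists>mj. reroutes pq mj" if "pq \<in> A" for pq
    using left_reroute_corner[OF L, of "fst pq" M "snd pq"] that by (auto simp: A_def reroutes_def)
  then obtain mj where mj: "\<And>pq. pq \<in> A \<Longrightarrow> reroutes pq (mj pq)" by metis
  define m where "m pq = fst (mj pq)" for pq
  define j where "j pq = snd (mj pq)" for pq
  define edge where "edge x pq = {(x, fst pq), (x :: int, snd pq :: int \<times> int)}" for x pq
  \<comment> \<open>The decoding undoes the reroutings in reverse order: shift back, cut at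
    \<open>s\<close> and restore the right edge, cut at 0 and restore the left edge. The old span
    \<open>s\<close> is the new one less both depths.\<close>
  define g where "g i R = (let s = polygon_span R - m (snd i) - m (fst i);
      Q = insert (edge s (snd i)) {e \<in> (`) (shift (- m (fst i))) ` R. e \<subseteq> {v. fst v \<le> s}}
    in insert (edge 0 (fst i)) {e \<in> Q. e \<subseteq> {v. 0 \<le> fst v}})" for i R
  have recover: "\<exists>i\<in>A \<times> A. \<exists>R\<in>capped_polygons L M (n + 2 * (j (fst i) + j (snd i))).
      E = g i R \<and> polygon_span E \<le> polygon_span R"
    if E: "E \<in> tube_polygons_of_length L M n" for E n
  proof -
    have T: "E \<in> tube_polygons L M" and n: "card E = n"
      using E by (simp_all add: tube_polygons_of_length_def)
    note P = tube_polygon_is_polygon[OF T]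
    define s where "s = polygon_span E"
    have s: "0 \<le> s" using tube_polygon_span_nonneg[OF T] by (simp add: s_def)
    have V: "\<forall>v\<in>\<Union>E. 0 \<le> fst v \<and> snd v \<in> ?G" using tube_polygon_vertex[OF T] by blast
    have le_s: "fst v \<le> s" if "v \<in> \<Union>E" for v using polygon_span_ge[OF P that] by (simp add: s_def)
    obtain v0 where v0: "v0 \<in> \<Union>E" "fst v0 = 0" using tube_polygon_origin[OF T] by blast
    obtain v1 where v1: "v1 \<in> \<Union>E" "fst v1 = s" using polygon_span_attained[OF P] by (metis s_def)
    have "hinge E 0 \<noteq> {}" using hinge_nonempty_extremal[OF P v0] V by blast
    from plane_edge_of_hinge[OF P this] obtain p q where
      pq: "{(0, p), (0, q)} \<in> E" "unit_dist (0, p) (0, q)" .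
    have "(0, p) \<in> \<Union>E" "(0, q) \<in> \<Union>E" using pq(1) by blast+
    from this[THEN bspec[OF V]] have A1: "(p, q) \<in> A" using pq(2) by (simp add: A_def)
    have m1: "1 \<le> m (p, q)" and r1: "left_reroute ?G p q (0, 0) (1, 0) (m (p, q)) (j (p, q))"
      using mj[OF A1] by (simp_all add: reroutes_def m_def j_def)
    obtain Q where Q: "extends {v. 0 \<le> fst v} {(0, p), (0, q)} E Q"
      "\<forall>v\<in>\<Union>Q. 0 - m (p, q) \<le> fst v \<and> snd v \<in> ?G" "corner (0 - m (p, q)) \<in> Q"
      "card Q = card E + 2 * j (p, q)"
      by (rule left_rerouteE[OF r1 P V pq(1)])
    note PQ = extends_polygon[OF Q(1)]
    have VQ: "- m (p, q) \<le> fst v \<and> fst v \<le> s \<and> snd v \<in> ?G" if v: "v \<in> \<Union>Q" for v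
    proof (cases "0 \<le> fst v")
      case True
      then have "v \<in> \<Union>E" using v extends_new_vertices[OF Q(1)] by blast
      then show ?thesis using le_s bspec[OF Q(2) v] by simp
    next
      case False
      then show ?thesis using s bspec[OF Q(2) v] by simp
    qed
    \<comment> \<open>The right edge is chosen in \<open>Q\<close> rather than \<open>E\<close>: for
      \<open>s = 0\<close> the two end planes coincide, and an edge of \<open>E\<close> might be the
      one already removed.\<close>
    have "v1 \<in> \<Union>Q" using v1 extends_vertices[OF Q(1)] by blast
    then have "hinge Q s \<noteq> {}" using hinge_nonempty_extremal[OF PQ _ v1(2)] VQ by blast
    from plane_edge_of_hinge[OF PQ this] obtain p' q' where
      pq': "{(s, p'), (s, q')} \<in> Q" "unit_dist (0, p') (0, q')" .
    have "(s, p') \<in> \<Union>Q" "(s, q') \<in> \<Union>Q" using pq'(1) by blast+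
    from this[THEN VQ] have A2: "(p', q') \<in> A" using pq'(2) by (simp add: A_def)
    have m2: "1 \<le> m (p', q')" and r2: "left_reroute ?G p' q' (0, 0) (1, 0) (m (p', q')) (j (p', q'))"
      using mj[OF A2] by (simp_all add: reroutes_def m_def j_def)
    have c: "corner (- m (p, q)) \<in> Q" using Q(3) by simp
    have sm: "1 \<le> s + m (p, q)" using s m1 by simp
    obtain R where R: "extends {v. fst v \<le> s} {(s, p'), (s, q')} Q R"
      "(`) (shift (m (p, q))) ` R \<in> capped_polygons L M (card Q + 2 * j (p', q'))"
      "polygon_span ((`) (shift (m (p, q))) ` R) = s + m (p', q') + m (p, q)"
      by (rule extend_right[OF left_reroute_imp_right_reroute[OF r2] m2 sm s PQ VQ c pq'(1)])
    let ?i = "((p, q), (p', q'))" and ?R = "(`) (shift (m (p, q))) ` R"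
    have "E = g ?i ?R"
      using extends_recover[OF R(1) pq'(1)] extends_recover[OF Q(1) pq(1)]
      by (simp add: g_def Let_def R(3) shift_image_shift_image shift_image_0 edge_def)
    moreover have "polygon_span E \<le> polygon_span ?R" using R(3) m1 m2 by (simp add: s_def)
    moreover have "?R \<in> capped_polygons L M (n + 2 * (j (fst ?i) + j (snd ?i)))"
      using R(2) Q(4) n by (simp add: algebra_simps)
    ultimately show ?thesis using A1 A2 by (intro bexI[of _ ?i] bexI[of _ ?R]) simp_all
  qed
  \<comment> \<open>Different end edges cost different numbers of edges; monotonicity pads all of
    them to the largest cost.\<close>
  define J where "J = Max (insert 0 ((\<lambda>i. j (fst i) + j (snd i)) ` (A \<times> A)))"
  show ?thesis
  proof (rule that[of "card (A \<times> A)" J])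
    fix n :: nat and f :: real assume f: "0 \<le> f"
    have mono: "capped_partition L M (n + 2 * a) f \<le> capped_partition L M (n + 2 * b) f" if "a \<le> b" for a b
      using that
    proof (induction rule: dec_induct)
      case (step b)
      then show ?case using capped_partition_mono[OF f, of L M "n + 2 * b"] by simp
    qed simp
    have "partition_function L M n f \<le>
       (\<Sum>i\<in>A \<times> A. \<Sum>E\<in>capped_polygons L M (n + 2 * (j (fst i) + j (snd i))). exp (f * real_of_int (polygon_span E)))"
      unfolding partition_function_eq
    proof (rule sum_le_sum_of_recover[where g = g])
      fix E assume "E \<in> tube_polygons_of_length L M n"
      from recover[OF this] obtain i R where iR: "i \<in> A \<times> A"
        "R \<in> capped_polygons L M (n + 2 * (j (fst i) + j (snd i)))" "E = g i R"
        "polygon_span E \<le> polygon_span R" by blast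
      have "exp (f * real_of_int (polygon_span E)) \<le> exp (f * real_of_int (polygon_span R))"
        using f iR(4) by (simp add: mult_left_mono)
      then show "\<exists>i\<in>A \<times> A. \<exists>R\<in>capped_polygons L M (n + 2 * (j (fst i) + j (snd i))). E = g i R \<and>
          exp (f * real_of_int (polygon_span E)) \<le> exp (f * real_of_int (polygon_span R))"
        using iR by blast
    qed (simp_all add: finA finite_capped_polygons)
    also have "\<dots> \<le> (\<Sum>i\<in>A \<times> A. capped_partition L M (n + 2 * J) f)"
      unfolding capped_partition_def[symmetric]
      by (intro sum_mono mono) (auto simp: J_def finA intro!: Max_ge)
    also have "\<dots> = real (card (A \<times> A)) * capped_partition L M (n + 2 * J) f" by simp
    finally show "partition_function L M n f \<le> real (card (A \<times> A)) * capped_partition L M (n + 2 * J) f" .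
  qed
qed

lemma capped_partition_le: "capped_partition L M n f \<le> partition_function L M n f"
  unfolding partition_function_eq capped_partition_def
  by (rule sum_mono2[OF finite_tube_polygons_of_length]) (auto simp: capped_polygons_def)

section \<open>Concatenation and the limit\<close>

text \<open>The shift by \<open>s + 1\<close> places the right cap of \<open>E\<close> and the left
  cap of \<open>F\<close> on opposite sides of a unit square. Exchanging these two sides for the
  other two merges the polygons, so lengths add exactly.\<close>

definition concat_polygons :: "vertex set set \<Rightarrow> vertex set set \<Rightarrow> vertex set set" where
  "concat_polygons E F = (let s = polygon_span E in
     E - {corner s} \<union> ((`) (shift (s + 1)) ` F - {corner (s + 1)}) \<union>
     {{(s, 0, 0), (s + 1, 0, 0)}, {(s, 1, 0), (s + 1, 1, 0)}})"

lemma capped_vertex: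
  assumes "E \<in> capped_polygons L M n" "v \<in> \<Union>E"
  shows "0 \<le> fst v \<and> fst v \<le> polygon_span E \<and> snd v \<in> grid L M"
  using tube_polygon_vertex[OF capped_tube[OF assms(1)] assms(2)]
    polygon_span_ge[OF capped_polygon[OF assms(1)] assms(2)] by simp

text \<open>The first two claims give the length and weight of the product; the last two recover
  both factors once the cutting plane is known.\<close>

lemma
  assumes E: "E \<in> capped_polygons L M m" and F: "F \<in> capped_polygons L M n"
  defines "s \<equiv> polygon_span E"
  shows concat_capped: "concat_polygons E F \<in> capped_polygons L M (m + n)"
    and concat_span: "polygon_span (concat_polygons E F) = s + 1 + polygon_span F"
    and concat_left_part: "{e \<in> concat_polygons E F. e \<subseteq> {v. fst v \<le> s}} = E - {corner s}"
    and concat_right_part: "{e \<in> concat_polygons E F. e \<subseteq> {v. s + 1 \<le> fst v}} =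
      (`) (shift (s + 1)) ` F - {corner (s + 1)}"
proof -
  let ?G = "concat_polygons E F" and ?F = "(`) (shift (s + 1)) ` F"
  note PE = capped_polygon[OF E]
  have PF: "is_polygon ?F" by (rule polygon_image[OF lattice_embedding_shift capped_polygon[OF F]])
  have s: "1 \<le> s" using capped_span[OF E] by (simp add: s_def)
  have cF: "corner (s + 1) \<in> ?F" "corner (s + 1 + polygon_span F) \<in> ?F"
    using imageI[OF capped_left[OF F], of "(`) (shift (s + 1))"]
      imageI[OF capped_right[OF F], of "(`) (shift (s + 1))"] by (simp_all add: add.commute)
  have cE: "corner s \<in> E" using capped_right[OF E] by (simp add: s_def)
  note arc = is_arc_polygon_remove_edge[OF PF cF(1)]
  have UF: "\<Union>(?F - {corner (s + 1)}) = \<Union>?F" by (rule Union_polygon_remove_edge[OF PF])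
  have VE: "0 \<le> fst v \<and> fst v \<le> s \<and> snd v \<in> grid L M" if "v \<in> \<Union>E" for v
    using capped_vertex[OF E that] by (simp add: s_def)
  have VF: "s + 1 \<le> fst v \<and> fst v \<le> s + 1 + polygon_span F \<and> snd v \<in> grid L M" if "v \<in> \<Union>?F" for v
    using that capped_vertex[OF F] unfolding Union_image_image by (elim imageE) simp
  have "v \<notin> \<Union>E" if "v \<in> \<Union>?F" for v using VE[of v] VF[OF that] by auto
  then have disj: "\<Union>(?F - {corner (s + 1)}) \<inter> \<Union>E = {}" unfolding UF by blast
  have ud: "unit_dist (s, 0, 0) (s + 1, 0, 0)" "unit_dist (s, 1, 0) (s + 1, 1, 0)"
    by (simp_all add: unit_dist_axis)
  have G: "?G = E - {corner s} \<union> (?F - {corner (s + 1)}) \<union>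
     {{(s, 0, 0), (s + 1, 0, 0)}, {(s, 1, 0), (s + 1, 1, 0)}}"
    by (simp add: concat_polygons_def Let_def s_def)
  note sp = splice[OF PE cE arc disj ud, folded G]
  have UG: "\<Union>?G = \<Union>E \<union> \<Union>?F" using sp(3) UF by simp
  have VG: "0 \<le> fst v \<and> fst v \<le> s + 1 + polygon_span F \<and> snd v \<in> grid L M" if "v \<in> \<Union>?G" for v
    using that VE[of v] VF[of v] s capped_span[OF F] unfolding UG by (elim UnE) auto
  have l: "corner 0 \<in> ?G" unfolding G using capped_left[OF E] s by (simp add: doubleton_eq_iff)
  have r: "corner (s + 1 + polygon_span F) \<in> ?G"
    unfolding G using cF(2) capped_span[OF F] by (simp add: doubleton_eq_iff)
  have "card (?F - {corner (s + 1)}) + 1 = n"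
    using card_Suc_Diff1[OF polygon_finite[OF PF] cF(1)] card_image_image[OF inj_shift, of "s + 1" F]
      capped_card[OF F] by simp
  then have n: "card ?G = m + n" using sp(2) capped_card[OF E] by simp
  have t: "1 \<le> s + 1 + polygon_span F" using s capped_span[OF F] by simp
  show "?G \<in> capped_polygons L M (m + n)" "polygon_span ?G = s + 1 + polygon_span F"
    using cappedI[OF sp(1) VG t l r n] by simp_all
  have E_left: "e \<subseteq> {v. fst v \<le> s}" if "e \<in> E" for e using VE that by blast
  have F_right: "e \<subseteq> {v. s + 1 \<le> fst v}" if "e \<in> ?F" for e using VF that by blast
  have E_ne: "e \<noteq> {}" if "e \<in> E" for e using polygon_edgeE[OF PE that] by (metis insert_not_empty)
  have F_ne: "e \<noteq> {}" if "e \<in> ?F" for e using polygon_edgeE[OF PF that] by (metis insert_not_empty)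
  have sep: "{v :: vertex. fst v \<le> s} \<inter> {v. s + 1 \<le> fst v} = {}" by auto
  have not_left: "\<not> e \<subseteq> {v. fst v \<le> s}" if "e \<in> ?F" for e
    using F_right[OF that] F_ne[OF that] sep by blast
  have not_right: "\<not> e \<subseteq> {v. s + 1 \<le> fst v}" if "e \<in> E" for e
    using E_left[OF that] E_ne[OF that] sep by blast
  have "\<not> {(s, p), (s + 1, p)} \<subseteq> {v. fst v \<le> s}" "\<not> {(s, p), (s + 1, p)} \<subseteq> {v. s + 1 \<le> fst v}"
    for p :: "int \<times> int" by auto
  note bridge = this
  have filter: "{e \<in> X \<union> Y \<union> {a, b}. P e} = X" "{e \<in> Y \<union> X \<union> {a, b}. P e} = X"
    if "\<And>e. e \<in> X \<Longrightarrow> P e" "\<And>e. e \<in> Y \<Longrightarrow> \<not> P e" "\<not> P a" "\<not> P b"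
    for X Y :: "vertex set set" and a b P
    using that by blast+
  show "{e \<in> ?G. e \<subseteq> {v. fst v \<le> s}} = E - {corner s}"
    unfolding G by (rule filter(1)[where P = "\<lambda>e. e \<subseteq> {v. fst v \<le> s}"]) (erule DiffD1[THEN E_left] DiffD1[THEN not_left] | rule bridge)+
  show "{e \<in> ?G. e \<subseteq> {v. s + 1 \<le> fst v}} = ?F - {corner (s + 1)}"
    unfolding G by (rule filter(2)[where P = "\<lambda>e. e \<subseteq> {v. s + 1 \<le> fst v}"]) (erule DiffD1[THEN F_right] DiffD1[THEN not_right] | rule bridge)+
qed

text \<open>The cutting plane is not known in advance, but the lengths are. The part to the left of
  the earlier cut lies inside the part to the left of the later one, and both have the same number
  of edges, so they agree.\<close>

lemma concat_polygons_inj_aux: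
  assumes E: "E \<in> capped_polygons L M m" and F: "F \<in> capped_polygons L M n"
    and E': "E' \<in> capped_polygons L M m" and F': "F' \<in> capped_polygons L M n"
    and eq: "concat_polygons E F = concat_polygons E' F'" and le: "polygon_span E \<le> polygon_span E'"
  shows "E = E' \<and> F = F'"
proof -
  let ?s = "polygon_span E" and ?s' = "polygon_span E'"
  have "{e \<in> concat_polygons E F. e \<subseteq> {v. fst v \<le> ?s}} \<subseteq> {e \<in> concat_polygons E' F'. e \<subseteq> {v. fst v \<le> ?s'}}"
    using eq le by auto
  then have sub: "E - {corner ?s} \<subseteq> E' - {corner ?s'}"
    unfolding concat_left_part[OF E F] concat_left_part[OF E' F'] .
  have "card (E - {corner ?s}) = card (E' - {corner ?s'})"
    using capped_right[OF E] capped_right[OF E'] capped_card[OF E] capped_card[OF E']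
      polygon_finite[OF capped_polygon[OF E]] polygon_finite[OF capped_polygon[OF E']]
    by (simp add: card_Diff_singleton)
  then have D: "E - {corner ?s} = E' - {corner ?s'}"
    by (intro card_subset_eq sub finite_Diff polygon_finite[OF capped_polygon[OF E']])
  \<comment> \<open>Removing one edge loses no vertex, so equality of the opened polygons already
    determines the span and thereby the missing cap.\<close>
  then have "\<Union>E = \<Union>E'"
    using Union_polygon_remove_edge[OF capped_polygon[OF E]] Union_polygon_remove_edge[OF capped_polygon[OF E']]
    by metis
  then have s: "?s = ?s'" by (simp add: polygon_span_def)
  have EE: "E = E'"
    using D s insert_Diff[OF capped_right[OF E]] insert_Diff[OF capped_right[OF E']] by metis
  let ?t = "(`) (shift (?s + 1))"
  have R: "?t ` F - {corner (?s + 1)} = ?t ` F' - {corner (?s + 1)}"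
    using concat_right_part[OF E F] concat_right_part[OF E' F'] eq s by metis
  have c: "corner (?s + 1) \<in> ?t ` H" if "H \<in> capped_polygons L M n" for H
    using imageI[OF capped_left[OF that], of ?t] by simp
  have "?t ` F = ?t ` F'" using R insert_Diff[OF c[OF F]] insert_Diff[OF c[OF F']] by metis
  then show ?thesis using EE inj_image_eq_iff[OF inj_image[OF inj_shift]] by metis
qed

text \<open>Concatenation is injective for fixed lengths and yields one unit of span more than the
  sum, which can only increase the weight for \<open>0 \<le> f\<close>.\<close>

lemma capped_partition_supermult:
  assumes f: "0 \<le> f"
  shows "capped_partition L M m f * capped_partition L M n f \<le> capped_partition L M (m + n) f"
proof -
  let ?A = "capped_polygons L M m" and ?B = "capped_polygons L M n"
  let ?w = "\<lambda>E. exp (f * real_of_int (polygon_span E))"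
  let ?c = "\<lambda>(E, F). concat_polygons E F"
  have inj: "inj_on ?c (?A \<times> ?B)"
  proof (rule inj_onI, clarify)
    fix E F E' F' assume m: "E \<in> ?A" "F \<in> ?B" "E' \<in> ?A" "F' \<in> ?B"
      and eq: "concat_polygons E F = concat_polygons E' F'"
    show "E = E' \<and> F = F'"
    proof (cases "polygon_span E \<le> polygon_span E'")
      case True
      then show ?thesis by (rule concat_polygons_inj_aux[OF m eq])
    next
      case False
      then show ?thesis using concat_polygons_inj_aux[OF m(3,4,1,2) eq[symmetric]] by simp
    qed
  qed
  have "capped_partition L M m f * capped_partition L M n f = (\<Sum>(E, F)\<in>?A \<times> ?B. ?w E * ?w F)"
    by (simp add: capped_partition_def sum_product sum.cartesian_product)
  also have "\<dots> \<le> (\<Sum>EF\<in>?A \<times> ?B. ?w (?c EF))"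
  proof (rule sum_mono, clarify)
    fix E F assume EF: "E \<in> ?A" "F \<in> ?B"
    show "?w E * ?w F \<le> ?w (concat_polygons E F)"
      unfolding concat_span[OF EF] exp_add[symmetric] using f by (simp add: algebra_simps)
  qed
  also have "\<dots> = (\<Sum>G\<in>?c ` (?A \<times> ?B). ?w G)" by (simp add: sum.reindex[OF inj])
  also have "\<dots> \<le> (\<Sum>G\<in>capped_polygons L M (m + n). ?w G)"
    by (rule sum_mono2[OF finite_capped_polygons]) (auto intro: concat_capped)
  finally show ?thesis by (simp add: capped_partition_def)
qed

section \<open>Straight rectangles and the lower bound\<close>

lemma square_capped:
  assumes L: "1 \<le> L"
  obtains E where "E \<in> capped_polygons L M 4" "polygon_span E = 1"
proof -
  define a b c d :: vertex where "a = (0, 0, 0)" and "b = (0, 1, 0)" and "c = (1, 1, 0)" and "d = (1, 0, 0)"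
  note defs = a_def b_def c_def d_def
  let ?E = "{{a, b}, {b, c}, {c, d}, {d, a}}"
  have ne: "a \<noteq> b" "a \<noteq> c" "a \<noteq> d" "b \<noteq> c" "b \<noteq> d" "c \<noteq> d" by (simp_all add: defs)
  have U: "\<Union>?E = {a, b, c, d}" by auto
  have adj: "(a, b) \<in> adj ?E" "(b, c) \<in> adj ?E" "(c, d) \<in> adj ?E" by simp_all
  have a: "(a, w) \<in> (adj ?E)\<^sup>*" if w: "w \<in> {a, b, c, d}" for w
  proof -
    have b: "(a, b) \<in> (adj ?E)\<^sup>*" using adj(1) by (rule r_into_rtrancl)
    have c: "(a, c) \<in> (adj ?E)\<^sup>*" using b adj(2) by (rule rtrancl_into_rtrancl)
    have d: "(a, d) \<in> (adj ?E)\<^sup>*" using c adj(3) by (rule rtrancl_into_rtrancl)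
    show ?thesis using w b c d by (metis insertE rtrancl.rtrancl_refl singletonD)
  qed
  have deg: "card {e \<in> ?E. w \<in> e} = 2" if w: "w \<in> {a, b, c, d}" for w
  proof -
    have stars: "{e \<in> ?E. a \<in> e} = {{a, b}, {d, a}}" "{e \<in> ?E. b \<in> e} = {{a, b}, {b, c}}"
      "{e \<in> ?E. c \<in> e} = {{b, c}, {c, d}}" "{e \<in> ?E. d \<in> e} = {{c, d}, {d, a}}"
      using ne by blast+
    have cards: "card {{a, b}, {d, a}} = 2" "card {{a, b}, {b, c}} = 2"
      "card {{b, c}, {c, d}} = 2" "card {{c, d}, {d, a}} = 2"
      using ne by (simp_all add: card_2_iff' doubleton_eq_iff)
    consider "w = a" | "w = b" | "w = c" | "w = d" using w by blast
    then show ?thesis by cases (simp_all only: stars cards)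
  qed
  have P: "is_polygon ?E"
    unfolding is_polygon_def connected_edges_def U
  proof (intro conjI ballI)
    show "(u, v) \<in> (adj ?E)\<^sup>*" if "u \<in> {a, b, c, d}" "v \<in> {a, b, c, d}" for u v
      by (rule rtrancl_trans[OF adj_rtrancl_sym[OF a[OF that(1)]] a[OF that(2)]])
    show "?E \<subseteq> lattice_edges" by (simp add: lattice_edge_iff) (simp add: defs)
    show "card {e \<in> ?E. v \<in> e} = 2" if "v \<in> {a, b, c, d}" for v using that by (rule deg)
  qed simp_all
  have V: "0 \<le> fst v \<and> fst v \<le> 1 \<and> snd v \<in> grid L M" if "v \<in> \<Union>?E" for v
    using that L unfolding U by (auto simp: defs grid_def)
  have n: "card ?E = 4" using ne by (simp add: doubleton_eq_iff)
  have "corner 0 \<in> ?E" "corner 1 \<in> ?E" by (auto simp: defs)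
  from cappedI[OF P V _ this n] show ?thesis by (rule that) simp_all
qed

text \<open>The rectangle of width 1 and span \<open>s\<close> has \<open>2 * s + 2\<close> edges;
  the offsets start the induction at the unit square.\<close>

lemma straight_capped:
  assumes L: "1 \<le> L"
  shows "\<exists>E \<in> capped_polygons L M (2 * (k + 2)). polygon_span E = int (k + 1)"
proof (induction k)
  case 0
  show ?case using square_capped[OF L, of M] by (metis mult_2_right add_0 numeral_Bit0 of_nat_1)
next
  case (Suc k)
  then obtain E where E: "E \<in> capped_polygons L M (2 * (k + 2))" "polygon_span E = int (k + 1)" by blast
  obtain R where R: "R \<in> capped_polygons L M (2 * (k + 2) + 2)" "polygon_span R = polygon_span E + 1"
    by (rule capped_extend[OF E(1)])
  then show ?case using E(2) by (intro bexI[of _ R]) simp_all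
qed

lemma capped_partition_ge:
  assumes "1 \<le> L" "2 \<le> k"
  shows "exp (f * (real k - 1)) \<le> capped_partition L M (2 * k) f"
proof -
  obtain E where E: "E \<in> capped_polygons L M (2 * (k - 2 + 2))" "polygon_span E = int (k - 2 + 1)"
    using straight_capped[OF assms(1)] by blast
  have k: "k - 2 + 2 = k" "k - 2 + 1 = k - 1" using assms(2) by simp_all
  have "exp (f * real_of_int (polygon_span E)) \<le> capped_partition L M (2 * k) f"
    unfolding capped_partition_def
    by (rule member_le_sum[OF E(1)[unfolded k]]) (simp_all add: finite_capped_polygons)
  then show ?thesis using E(2) k assms(2) by (simp add: of_nat_diff)
qed

text \<open>Fekete's lemma, with the supremum of \<open>a n / real n\<close> over positive
  \<open>n\<close> as the limit. Nonnegativity disposes of remainders.\<close>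

lemma superadditive_tendsto:
  fixes a :: "nat \<Rightarrow> real"
  assumes super: "\<And>m n. a m + a n \<le> a (m + n)" and nonneg: "\<And>n. 0 \<le> a n"
    and bound: "\<And>n. 1 \<le> n \<Longrightarrow> a n \<le> C * real n"
  obtains l where "(\<lambda>n. a n / real n) \<longlonglongrightarrow> l"
proof
  let ?S = "(\<lambda>n. a n / real n) ` {1..}"
  have bdd: "bdd_above ?S"
    by (rule bdd_aboveI2[where M = C]) (use bound in \<open>simp add: divide_le_eq\<close>)
  have mult: "real q * a m \<le> a (q * m)" for q m
  proof (induction q)
    case (Suc q)
    then show ?case using super[of m "q * m"] by (simp add: algebra_simps)
  qed (simp add: nonneg)
  show "(\<lambda>n. a n / real n) \<longlonglongrightarrow> Sup ?S"
  proof (rule order_tendstoI)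
    fix x assume x: "Sup ?S < x"
    have "a n / real n < x" if "1 \<le> n" for n
      using cSup_upper[OF _ bdd, of "a n / real n"] that x by fastforce
    then show "\<forall>\<^sub>F n in sequentially. a n / real n < x"
      using eventually_ge_at_top[of 1] by (rule eventually_mono[rotated])
  next
    fix x assume "x < Sup ?S"
    then obtain m where m: "1 \<le> m" "x < a m / real m"
      using less_cSup_iff[OF _ bdd, of x] by auto
    \<comment> \<open>Division of \<open>n\<close> by \<open>m\<close> with the remainder term
      dropped; the quotient is at least \<open>real n / real m - 1\<close>.\<close>
    have lower: "a m / real m - a m / real n \<le> a n / real n" if "1 \<le> n" for n
    proof -
      have "real n \<le> real (n div m) * real m + real m"
        using m(1) div_mult_mod_eq[of n m] mod_less_divisor[of m n]
        by (metis add_left_mono less_imp_le of_nat_add of_nat_le_iff of_nat_mult zero_less_one less_le_trans)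
      then have "real n / real m - 1 \<le> real (n div m)" using m(1) by (simp add: field_simps)
      then have "(real n / real m - 1) * a m \<le> real (n div m) * a m" using nonneg by (rule mult_right_mono)
      also have "\<dots> \<le> a (n div m * m)" by (rule mult)
      also have "\<dots> \<le> a n" using super[of "n div m * m" "n mod m"] nonneg[of "n mod m"] by simp
      finally have "(real n / real m - 1) * a m / real n \<le> a n / real n" by (rule divide_right_mono) simp
      moreover have "(real n / real m - 1) * a m / real n = a m / real m - a m / real n"
        using that m(1) by (simp add: field_simps)
      ultimately show ?thesis by simp
    qed
    have "(\<lambda>n. a m / real m - a m / real n) \<longlonglongrightarrow> a m / real m - 0"
      by (intro tendsto_intros lim_const_over_n)
    then have "\<forall>\<^sub>F n in sequentially. x < a m / real m - a m / real n"
      using m(2) by (intro order_tendstoD(1)) simp_all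
    then show "\<forall>\<^sub>F n in sequentially. x < a n / real n"
      using eventually_ge_at_top[of 1] by eventually_elim (use lower in fastforce)
  qed
qed

text \<open>Fekete's lemma applies to the capped partition function \<open>D\<close>, and
  \<open>D k \<le> Z k \<le> real N * D (k + j)\<close> transfers its growth rate to
  \<open>Z\<close>. The bounds on the limit come from the rectangle and from the plane
  codes.\<close>

lemma ln_partition_function_tendsto:
  assumes L: "1 \<le> L" and f: "0 \<le> f"
  obtains l where "(\<lambda>k. ln (partition_function L M (2 * k) f) / real (2 * k)) \<longlonglongrightarrow> l"
    "f / 2 \<le> l" "l \<le> f / 2 + ln (1 + real (card (plane_codes L M)) * exp (- f / 2)) / 2"
proof -
  define B where "B = 1 + real (card (plane_codes L M)) * exp (- f / 2)"
  define D where "D k = capped_partition L M (2 * k) f" for k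
  define Z where "Z k = partition_function L M (2 * k) f" for k
  define a where "a k = ln (D k)" for k
  have B: "1 \<le> B" by (simp add: B_def)
  have DZ: "D k \<le> Z k" for k by (simp add: D_def Z_def capped_partition_le)
  \<comment> \<open>Each summand is at least 1. Since \<open>ln 0 = 0\<close>, the sequence
    \<open>a\<close> is nonnegative even at lengths without capped polygons.\<close>
  have D_cases: "D k = 0 \<or> 1 \<le> D k" for k
  proof (cases "capped_polygons L M (2 * k) = {}")
    case True
    then show ?thesis by (simp add: D_def capped_partition_def)
  next
    case False
    then obtain E where E: "E \<in> capped_polygons L M (2 * k)" by blast
    have "1 \<le> exp (f * real_of_int (polygon_span E))" using f capped_span[OF E] by simp
    also have "\<dots> \<le> D k"
      unfolding D_def capped_partition_def by (rule member_le_sum[OF E]) (simp_all add: finite_capped_polygons)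
    finally show ?thesis by simp
  qed
  have D_Suc: "D k \<le> D (Suc k)" for k using capped_partition_mono[OF f, of L M "2 * k"] by (simp add: D_def)
  have D_mono: "D k \<le> D (k + i)" for k i using lift_Suc_mono_le[of D, OF D_Suc, of k "k + i"] by simp
  have a_nonneg: "0 \<le> a k" for k using D_cases[of k] by (auto simp: a_def)
  have a_mono: "a k \<le> a (k + i)" for k i
    using D_cases[of k] D_mono[of k i] a_nonneg[of "k + i"] by (auto simp: a_def)
  \<comment> \<open>If one factor vanishes, its logarithm is 0 by convention and monotonicity takes
    the place of supermultiplicativity.\<close>
  have super: "a k + a i \<le> a (k + i)" for k i
  proof (cases "D k = 0 \<or> D i = 0")
    case True
    then show ?thesis using a_mono[of k i] a_mono[of i k] by (auto simp: a_def add.commute)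
  next
    case False
    then have pos: "1 \<le> D k" "1 \<le> D i" using D_cases by blast+
    have "D k * D i \<le> D (k + i)"
      using capped_partition_supermult[OF f, of L M "2 * k" "2 * i"] by (simp add: D_def algebra_simps)
    moreover have "0 < D k * D i" using pos by (intro mult_pos_pos) simp_all
    ultimately have "ln (D k * D i) \<le> ln (D (k + i))" by (simp add: ln_le_cancel_iff)
    then show ?thesis using pos by (simp add: a_def ln_mult_pos)
  qed
  have D_ge: "exp (f * (real k - 1)) \<le> D k" if "2 \<le> k" for k
    using capped_partition_ge[OF L that] by (simp add: D_def)
  have Z_pos: "1 \<le> Z k" if "2 \<le> k" for k
  proof -
    have "1 \<le> exp (f * (real k - 1))" using f that by simp
    then show ?thesis using D_ge[OF that] DZ[of k] by linarith
  qed
  have Z_le: "ln (Z k) \<le> f * real k + ln (real (Suc k)) + real (Suc k) * ln B" if "0 < Z k" for k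
  proof -
    have "Z k \<le> exp (f * real k) * (real (Suc k) * B ^ Suc k)"
      using partition_function_le[OF f, of L M k] by (simp add: Z_def B_def)
    then have "ln (Z k) \<le> ln (exp (f * real k) * (real (Suc k) * B ^ Suc k))"
      using that by (rule ln_mono)
    also have "\<dots> = f * real k + (ln (real (Suc k)) + real (Suc k) * ln B)"
      using B by (simp add: ln_mult_pos ln_realpow del: power_Suc of_nat_Suc)
    finally show ?thesis by simp
  qed
  \<comment> \<open>Any linear bound will do: \<open>ln (real (Suc k))\<close> is at most
    \<open>real k\<close>, and \<open>Suc k\<close> is at most \<open>2 * k\<close>.\<close>
  have a_bound: "a k \<le> (f + 1 + 2 * ln B) * real k" if "1 \<le> k" for k
  proof (cases "D k = 0")
    case True
    then show ?thesis using f B by (simp add: a_def)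
  next
    case False
    then have "1 \<le> D k" using D_cases by blast
    then have "a k \<le> ln (Z k)" "0 < Z k" using DZ[of k] by (simp_all add: a_def)
    moreover have "ln (real (Suc k)) \<le> real k" using ln_add_one_self_le_self[of "real k"] by (simp add: add.commute)
    moreover have "real (Suc k) * ln B \<le> (2 * real k) * ln B" using that B by (intro mult_right_mono) simp_all
    ultimately show ?thesis using Z_le[of k] by (simp add: algebra_simps)
  qed
  obtain l where l: "(\<lambda>k. a k / real k) \<longlonglongrightarrow> l"
    by (rule superadditive_tendsto[OF super a_nonneg a_bound])
  obtain N j where Nj: "\<And>n f. 0 \<le> f \<Longrightarrow> partition_function L M n f \<le> real N * capped_partition L M (n + 2 * j) f"
    using partition_function_le_capped[OF L, of M] by blast
  have ZD: "Z k \<le> real N * D (k + j)" for k using Nj[OF f, of "2 * k"] by (simp add: Z_def D_def algebra_simps)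
  have lim: "(\<lambda>k. ln (Z k) / real (2 * k)) \<longlonglongrightarrow> l / 2"
  proof (rule tendsto_sandwich)
    show "\<forall>\<^sub>F k in sequentially. a k / real k / 2 \<le> ln (Z k) / real (2 * k)"
      using eventually_ge_at_top[of 2]
    proof eventually_elim
      case (elim k)
      have "0 < D k" using D_ge[OF elim] by (rule less_le_trans[rotated]) simp
      then have "a k \<le> ln (Z k)" using DZ[of k] by (simp add: a_def)
      then show ?case using elim by (simp add: field_simps)
    qed
    show "\<forall>\<^sub>F k in sequentially. ln (Z k) / real (2 * k) \<le>
        (ln (real N) / real k + a (k + j) / real (k + j) * (1 + real j / real k)) / 2"
      using eventually_ge_at_top[of 2]
    proof eventually_elim
      case (elim k)
      have "0 < real N * D (k + j)" using Z_pos[OF elim] ZD[of k] by linarith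
      then have pos: "0 < real N" "0 < D (k + j)" using D_cases[of "k + j"] by (auto simp: zero_less_mult_iff)
      have "ln (Z k) \<le> ln (real N * D (k + j))" using ZD[of k] Z_pos[OF elim] by (intro ln_mono) simp_all
      also have "\<dots> = ln (real N) + a (k + j)" using pos by (simp add: a_def ln_mult_pos)
      finally have "ln (Z k) / real (2 * k) \<le> (ln (real N) + a (k + j)) / real (2 * k)"
        by (rule divide_right_mono) simp
      also have "\<dots> = (ln (real N) / real k + a (k + j) / real (k + j) * (1 + real j / real k)) / 2"
      proof -
        have ratio: "1 + real j / real k = real (k + j) / real k" using elim by (simp add: field_simps)
        have "a (k + j) / real (k + j) * (real (k + j) / real k) = a (k + j) / real k"
          using elim by (simp del: of_nat_add)
        then show ?thesis unfolding ratio by (simp add: add_divide_distrib)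
      qed
      finally show ?case .
    qed
    show "(\<lambda>k. a k / real k / 2) \<longlonglongrightarrow> l / 2" by (intro tendsto_intros l) simp
    have "(\<lambda>k. (ln (real N) / real k + a (k + j) / real (k + j) * (1 + real j / real k)) / 2)
        \<longlonglongrightarrow> (0 + l * (1 + 0)) / 2"
      by (intro tendsto_intros lim_const_over_n LIMSEQ_ignore_initial_segment[OF l]) simp
    then show "(\<lambda>k. (ln (real N) / real k + a (k + j) / real (k + j) * (1 + real j / real k)) / 2)
        \<longlonglongrightarrow> l / 2" by simp
  qed
  have "(\<lambda>k. f / 2 - (f / 2) / real k) \<longlonglongrightarrow> f / 2 - 0"
    by (intro tendsto_intros lim_const_over_n)
  then have lower: "(\<lambda>k. f / 2 - (f / 2) / real k) \<longlonglongrightarrow> f / 2" by simp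
  have ln_over_n: "(\<lambda>n. ln (real n) / real n) \<longlonglongrightarrow> 0"
    by (rule filterlim_compose[OF ln_x_over_x_tendsto_0 filterlim_real_sequentially])
  \<comment> \<open>The bound on \<open>ln (Z k)\<close> divided by \<open>2 * k\<close>, arranged
    so that \<open>ln n / n\<close> at \<open>n = Suc k\<close> and the ratio
    \<open>Suc k / k\<close> appear.\<close>
  let ?u = "\<lambda>k. f / 2 + (ln (real (Suc k)) / real (Suc k) + ln B) * (1 + 1 / real k) / 2"
  have "?u \<longlonglongrightarrow> f / 2 + (0 + ln B) * (1 + 0) / 2"
    by (intro tendsto_intros lim_const_over_n LIMSEQ_Suc[OF ln_over_n]) simp
  then have upper: "?u \<longlonglongrightarrow> f / 2 + ln B / 2" by simp
  show ?thesis
  proof (rule that[OF lim[unfolded Z_def]])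
    show "f / 2 \<le> l / 2"
    proof (rule LIMSEQ_le[OF lower lim], intro exI[of _ 2] allI impI)
      fix k :: nat assume k: "2 \<le> k"
      have "exp (f * (real k - 1)) \<le> Z k" using D_ge[OF k] DZ[of k] by linarith
      then have "f * (real k - 1) \<le> ln (Z k)" using Z_pos[OF k] by (subst ln_ge_iff) simp_all
      then have "f * (real k - 1) / real (2 * k) \<le> ln (Z k) / real (2 * k)" by (rule divide_right_mono) simp
      moreover have "f * (real k - 1) / real (2 * k) = f / 2 - (f / 2) / real k" using k by (simp add: field_simps)
      ultimately show "f / 2 - (f / 2) / real k \<le> ln (Z k) / real (2 * k)" by simp
    qed
    show "l / 2 \<le> f / 2 + ln (1 + real (card (plane_codes L M)) * exp (- f / 2)) / 2"
      unfolding B_def[symmetric]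
    proof (rule LIMSEQ_le[OF lim upper], intro exI[of _ 2] allI impI)
      fix k :: nat assume k: "2 \<le> k"
      have "ln (Z k) / real (2 * k) \<le> (f * real k + ln (real (Suc k)) + real (Suc k) * ln B) / real (2 * k)"
        by (rule divide_right_mono[OF Z_le]) (use Z_pos[OF k] in simp_all)
      also have "\<dots> = ?u k"
      proof -
        have Suc: "1 + 1 / real k = real (Suc k) / real k" using k by (simp add: field_simps)
        have cancel: "(x / y + b) * (y / z) = (x + y * b) / z" if "y \<noteq> 0" for x y z b :: real
          using that by (simp add: distrib_right add_divide_distrib)
        have "(ln (real (Suc k)) / real (Suc k) + ln B) * (real (Suc k) / real k) =
            (ln (real (Suc k)) + real (Suc k) * ln B) / real k"
          by (rule cancel) simp
        moreover have "(f * x + y + z) / (2 * x) = f / 2 + (y + z) / x / 2" if "x \<noteq> 0" for x y z :: real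
          using that by (simp add: add_divide_distrib)
        ultimately show ?thesis unfolding Suc using k by simp
      qed
      finally show "ln (Z k) / real (2 * k) \<le> ?u k" .
    qed
  qed
qed

theorem theorem3:
  fixes L M :: nat
  assumes "M \<le> L" and "1 \<le> L"
  shows "((\<lambda>f::real. free_energy L M f - f / 2) \<longlongrightarrow> 0) at_top"
proof (rule tendsto_sandwich)
  let ?C = "real (card (plane_codes L M))"
  \<comment> \<open>The constant \<open>?C\<close> does not depend on \<open>f\<close>, so the error
    tends to \<open>ln 1 / 2 = 0\<close>.\<close>
  have bounds: "0 \<le> free_energy L M f - f / 2 \<and> free_energy L M f - f / 2 \<le> ln (1 + ?C * exp (- f / 2)) / 2"
    if f: "0 \<le> f" for f
  proof -
    obtain l where l: "(\<lambda>k. ln (partition_function L M (2 * k) f) / real (2 * k)) \<longlonglongrightarrow> l"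
      "f / 2 \<le> l" "l \<le> f / 2 + ln (1 + ?C * exp (- f / 2)) / 2"
      by (rule ln_partition_function_tendsto[OF assms(2) f])
    have "free_energy L M f = l" unfolding free_energy_def by (rule limI[OF l(1)])
    then show ?thesis using l(2,3) by simp
  qed
  show "\<forall>\<^sub>F f in at_top. 0 \<le> free_energy L M f - f / 2"
    using eventually_ge_at_top[of 0] by eventually_elim (use bounds in blast)
  show "\<forall>\<^sub>F f in at_top. free_energy L M f - f / 2 \<le> ln (1 + ?C * exp (- f / 2)) / 2"
    using eventually_ge_at_top[of 0] by eventually_elim (use bounds in blast)
  have "filterlim (\<lambda>f::real. (1 / 2) * f) at_top at_top"
    by (rule filterlim_tendsto_pos_mult_at_top[OF tendsto_const _ filterlim_ident]) simp
  then have "filterlim (\<lambda>f::real. - f / 2) at_bot at_top"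
    by (simp add: filterlim_uminus_at_bot)
  then have "((\<lambda>f::real. exp (- f / 2)) \<longlongrightarrow> 0) at_top"
    by (rule filterlim_compose[OF exp_at_bot])
  then have "((\<lambda>f. ln (1 + ?C * exp (- f / 2)) / 2) \<longlongrightarrow> ln (1 + ?C * 0) / 2) at_top"
    by (intro tendsto_intros) simp_all
  then show "((\<lambda>f. ln (1 + ?C * exp (- f / 2)) / 2) \<longlongrightarrow> 0) at_top" by simp
qed simp

end
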